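(* If $n\ge 2k+2>2$, then every intersecting family $\mathcal F\subseteq\binom{[n]}{k}$ satisfies $\delta_1(\mathcal F)\le\binom{n-2}{k-2}$. More generally, if $1\le t<k$ and $n\ge 2k+\frac{3t}{1-t/k}$, then every intersecting family $\mathcal F\subseteq\binom{[n]}{k}$ satisfies $\delta_t(\mathcal F)\le\binom{n-t-1}{k-t-1}$.
   Context: A family is intersecting if any two of its sets intersect. For $\mathcal F\subseteq\binom{[n]}{k}$ and $S\subseteq[n]$, the degree of $S$ is the number of sets of $\mathcal F$ containing $S$; $\delta_t(\mathcal F)$ is the minimum degree of a $t$-element subset $S\subseteq[n]$. *)

theory Defs
  imports Complex_Main "HOL-Library.Ramsey"
begin

definition intersecting :: "'a set set \<Rightarrow> bool" where
  "intersecting F \<longleftrightarrow> (\<forall>A\<in>F. \<forall>B\<in>F. A \<inter> B \<noteq> {})"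

definition degree :: "'a set set \<Rightarrow> 'a set \<Rightarrow> nat" where
  "degree F S = card {A \<in> F. S \<subseteq> A}"

(* The ground set is an explicit argument because F need not cover it.
   Min is meaningful only if V is finite and t \<le> card V. *)
definition min_degree :: "'a set \<Rightarrow> nat \<Rightarrow> 'a set set \<Rightarrow> nat" where
  "min_degree V t F = Min (degree F ` nsets V t)"

(* Integer lower index, with the usual value 0 when it is negative. Truncated
   subtraction would turn "n - 2 choose k - 2" into 1 at k = 1. *)
definition choose_int :: "nat \<Rightarrow> int \<Rightarrow> nat" where
  "choose_int n j = (if j < 0 then 0 else n choose nat j)"

end

theory Submission imports Defs begin

text \<open>Let \<open>D\<close> be the bound and call the number of members missing \<open>i\<close> the diversity at \<open>i\<close>.
  If some diversity is at most \<open>C(n-3,k-2)\<close>, then Kruskal--Katona, applied to the members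
  containing and missing \<open>i\<close>, bounds a weighted sum of the two parts, and the average degree over
  \<open>t\<close>-sets avoiding \<open>i\<close> is at most \<open>D\<close>. Otherwise, as in a theorem of Frankl, the family is no
  larger than the family of \<open>k\<close>-sets meeting a fixed triple in at least two points, and the average
  over all \<open>t\<close>-sets is at most \<open>D\<close>.

  For the latter size bound one shifts the family. If a shift makes one diversity drop to
  \<open>C(n-3,k-2)\<close>, split it by traces on the two points involved: parts with disjoint traces
  are cross-intersecting, which bounds their sizes directly. If the family becomes shifted, every member \<open>A\<close>
  satisfies \<open>2 |A \<inter> [p]| > p\<close> for some \<open>p\<close>, and members for which the least such \<open>p\<close> is large are
  exchanged, without loss of size, for sets containing 1, until the diversity at 1 lies just
  below \<open>C(n-3,k-2)\<close>, where Kruskal--Katona applies.\<close>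

section \<open>Shifting and shadows\<close>

text \<open>The compression replacing \<open>j\<close> by \<open>i\<close>; a member stays when its
  image is already present. New sets are recognised by their preimage, so membership is a plain test
  (\<open>mem_shift\<close>).\<close>

definition shift :: "'a \<Rightarrow> 'a \<Rightarrow> 'a set set \<Rightarrow> 'a set set" where
  "shift i j F = {A \<in> F. j \<in> A \<longrightarrow> i \<notin> A \<longrightarrow> insert i (A - {j}) \<in> F} \<union>
     {B. B \<notin> F \<and> i \<in> B \<and> j \<notin> B \<and> insert j (B - {i}) \<in> F}"

lemma mem_shift: "A \<in> shift i j F \<longleftrightarrow>
    A \<in> F \<and> (j \<in> A \<longrightarrow> i \<notin> A \<longrightarrow> insert i (A - {j}) \<in> F) \<or>
    A \<notin> F \<and> i \<in> A \<and> j \<notin> A \<and> insert j (A - {i}) \<in> F"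
  by (simp add: shift_def)

lemma shift_nsets:
  assumes "F \<subseteq> nsets V k" "i \<in> V"
  shows "shift i j F \<subseteq> nsets V k"
proof
  fix B assume "B \<in> shift i j F"
  then consider "B \<in> F" | "B \<notin> F" "i \<in> B" "j \<notin> B" "insert j (B - {i}) \<in> F"
    unfolding shift_def by blast
  then show "B \<in> nsets V k"
  proof cases
    case 2
    then have "insert j (B - {i}) \<in> nsets V k" using assms by blast
    then have *: "insert j (B - {i}) \<subseteq> V" "finite B" "card (insert j (B - {i})) = k"
      unfolding nsets_def by auto
    have "card (insert j (B - {i})) = Suc (card (B - {i}))"
      using 2 * by (intro card_insert_disjoint) auto
    also have "\<dots> = card B" using 2 * by (intro card_Suc_Diff1) auto
    finally show ?thesis using * 2 assms(2) unfolding nsets_def by auto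
  qed (use assms in auto)
qed

text \<open>\<open>M\<close> holds the members that really move. Cardinality and the sum of elements
  are both read off from this disjoint, injective splitting.\<close>

lemma shift_decomposition:
  assumes f: "f = (\<lambda>A. insert i (A - {j}))" and M: "M = {A \<in> F. j \<in> A \<and> i \<notin> A \<and> f A \<notin> F}"
  shows "shift i j F = (F - M) \<union> f ` M" "inj_on f M" "(F - M) \<inter> f ` M = {}"
proof -
  show "inj_on f M"
    by (rule inj_on_inverseI[where g = "\<lambda>B. insert j (B - {i})"]) (auto simp: M f)
  show "(F - M) \<inter> f ` M = {}" unfolding M by auto
  have "{B. B \<notin> F \<and> i \<in> B \<and> j \<notin> B \<and> insert j (B - {i}) \<in> F} = f ` M" (is "?L = _")
  proof
    show "?L \<subseteq> f ` M"
    proof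
      fix B assume B: "B \<in> ?L"
      then have "B = f (insert j (B - {i}))" unfolding f by auto
      moreover from this B have "insert j (B - {i}) \<in> M" unfolding M by auto
      ultimately show "B \<in> f ` M" by blast
    qed
    have "insert j (f A - {i}) = A" if "A \<in> M" for A
      using that unfolding M f by auto
    then show "f ` M \<subseteq> ?L" unfolding M by (auto simp: f)
  qed
  then show "shift i j F = (F - M) \<union> f ` M"
    unfolding shift_def by (auto simp: M f)
qed

lemma card_shift:
  assumes "finite F"
  shows "card (shift i j F) = card F"
proof -
  define f where "f = (\<lambda>A. insert i (A - {j}))"
  define M where "M = {A \<in> F. j \<in> A \<and> i \<notin> A \<and> f A \<notin> F}"
  note dec = shift_decomposition[OF f_def M_def]
  have M: "finite M" "M \<subseteq> F" using assms unfolding M_def by auto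
  have "card (shift i j F) = card (F - M) + card (f ` M)"
    unfolding dec(1) using assms M(1) dec(3) by (intro card_Un_disjoint) auto
  also have "card (f ` M) = card M" by (rule card_image[OF dec(2)])
  also have "card (F - M) + card M = card F"
    using card_Diff_subset[OF M] card_mono[OF assms M(2)] by simp
  finally show ?thesis .
qed

text \<open>Only an old \<open>A\<close> and a new \<open>B\<close> need care. If \<open>A\<close>
  contains \<open>j\<close> but not \<open>i\<close>, its swapped copy is in \<open>F\<close> and
  meets the preimage of \<open>B\<close> outside \<open>i\<close> and \<open>j\<close>. Otherwise
  \<open>A\<close> meets that preimage in a point of \<open>B\<close> or in \<open>j\<close>; in the
  latter case \<open>A\<close> and \<open>B\<close> share \<open>i\<close>.\<close>

lemma intersecting_shift:
  assumes "intersecting F"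
  shows "intersecting (shift i j F)"
proof -
  have int: "A \<inter> B \<noteq> {}" if "A \<in> F" "B \<in> F" for A B
    using assms that unfolding intersecting_def by blast
  have mixed: "A \<inter> B \<noteq> {}" if A: "A \<in> F" "j \<in> A \<longrightarrow> i \<notin> A \<longrightarrow> insert i (A - {j}) \<in> F"
    and B: "B \<notin> F" "i \<in> B" "j \<notin> B" "insert j (B - {i}) \<in> F" for A B
  proof (cases "j \<in> A \<and> i \<notin> A")
    case True
    then have "insert i (A - {j}) \<inter> insert j (B - {i}) \<noteq> {}" using int A B by blast
    then show ?thesis using B(2,3) True by auto
  next
    case False
    have "A \<inter> insert j (B - {i}) \<noteq> {}" using int A B by blast
    then show ?thesis using False B(2) by auto
  qed
  show ?thesis
    unfolding intersecting_def
  proof (intro ballI)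
    fix A B assume *: "A \<in> shift i j F" "B \<in> shift i j F"
    then show "A \<inter> B \<noteq> {}"
      using int[of A B] mixed[of A B] mixed[of B A] unfolding shift_def by blast
  qed
qed

definition shadow :: "'a set set \<Rightarrow> 'a set set" where
  "shadow G = {A. \<exists>x. x \<notin> A \<and> insert x A \<in> G}"

text \<open>Deleting \<open>x\<close> commutes with replacing \<open>j\<close> by \<open>i\<close>
  unless \<open>x\<close> is one of these points, and only \<open>x = i\<close> needs a separate
  argument. The inclusion shows that compression does not enlarge shadows.\<close>

lemma shadow_shift: "shadow (shift i j G) \<subseteq> shift i j (shadow G)"
proof
  fix A assume "A \<in> shadow (shift i j G)"
  then obtain x where x: "x \<notin> A" "insert x A \<in> shift i j G" unfolding shadow_def by blast
  have sh: "B \<in> shadow G" if "y \<notin> B" "insert y B \<in> G" for y B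
    using that unfolding shadow_def by blast
  show "A \<in> shift i j (shadow G)"
  proof (cases "i = j")
    case True
    then have "shift i j F = F" for F :: "'a set set" unfolding shift_def by auto
    then show ?thesis using x sh by metis
  next
    case ij: False
    from x(2) consider
      (old) "insert x A \<in> G" "j \<in> insert x A \<longrightarrow> i \<notin> insert x A \<longrightarrow> insert i (insert x A - {j}) \<in> G" |
      (new) "insert x A \<notin> G" "i \<in> insert x A" "j \<notin> insert x A" "insert j (insert x A - {i}) \<in> G"
      unfolding shift_def by blast
    then show ?thesis
    proof cases
      case old
      have "A \<in> shadow G" using sh old x by blast
      moreover have "insert i (A - {j}) \<in> shadow G" if "j \<in> A" "i \<notin> A"
      proof (cases "x = i")
        case True
        have "insert j (insert i (A - {j})) = insert x A" using True that by auto
        then show ?thesis using sh[of j "insert i (A - {j})"] old ij by auto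
      next
        case False
        have "insert i (insert x A - {j}) = insert x (insert i (A - {j}))" using False that x by auto
        then show ?thesis using sh[of x "insert i (A - {j})"] old that False x by auto
      qed
      ultimately show ?thesis unfolding shift_def by blast
    next
      case new
      show ?thesis
      proof (cases "x = i")
        case True
        then have "insert j (insert x A - {i}) = insert j A" using x by auto
        then have "A \<in> shadow G" using sh[of j A] new by auto
        then show ?thesis using new unfolding shift_def by auto
      next
        case False
        then have i: "i \<in> A" using new by auto
        have "insert j (insert x A - {i}) = insert x (insert j (A - {i}))" using False by auto
        then have "insert j (A - {i}) \<in> shadow G" using sh[of x "insert j (A - {i})"] new x by auto
        then show ?thesis using i new(3) unfolding shift_def by auto
      qed
    qed
  qed
qed

lemma shadow_nsets: "G \<subseteq> nsets V (Suc a) \<Longrightarrow> shadow G \<subseteq> nsets V a"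
  unfolding shadow_def nsets_def by auto

lemma finite_family: "finite V \<Longrightarrow> G \<subseteq> nsets V a \<Longrightarrow> finite G"
  by (meson finite_imp_finite_nsets finite_subset)

section \<open>Links and deletions at a point\<close>

definition link :: "'a \<Rightarrow> 'a set set \<Rightarrow> 'a set set" where
  "link v F = {A. v \<notin> A \<and> insert v A \<in> F}"

text \<open>Its cardinality is the diversity of \<open>F\<close> at \<open>v\<close>.\<close>

definition deletion :: "'a \<Rightarrow> 'a set set \<Rightarrow> 'a set set" where
  "deletion v F = {A \<in> F. v \<notin> A}"

lemma link_nsets:
  assumes "F \<subseteq> nsets V (Suc k)"
  shows "link v F \<subseteq> nsets (V - {v}) k"
proof
  fix A assume "A \<in> link v F"
  then have "v \<notin> A" "insert v A \<in> nsets V (Suc k)" using assms unfolding link_def by auto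
  then show "A \<in> nsets (V - {v}) k" unfolding nsets_def by auto
qed

lemma deletion_nsets: "F \<subseteq> nsets V k \<Longrightarrow> deletion v F \<subseteq> nsets (V - {v}) k"
  unfolding deletion_def nsets_def by auto

lemma link_deletion_decomposition: "F = deletion v F \<union> insert v ` link v F"
proof
  show "F \<subseteq> deletion v F \<union> insert v ` link v F"
  proof
    fix A assume A: "A \<in> F"
    show "A \<in> deletion v F \<union> insert v ` link v F"
    proof (cases "v \<in> A")
      case True
      then have "A = insert v (A - {v})" by auto
      moreover have "A - {v} \<in> link v F" using True A by (simp add: link_def insert_absorb)
      ultimately show ?thesis by blast
    qed (use A in \<open>auto simp: deletion_def\<close>)
  qed
qed (auto simp: link_def deletion_def)

lemma inj_on_insert: "\<forall>A\<in>F. v \<notin> A \<Longrightarrow> inj_on (insert v) F"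
  by (auto simp: inj_on_def)

lemma finite_link_deletion:
  assumes "finite F"
  shows "finite (link v F)" "finite (deletion v F)"
proof -
  have "insert v ` link v F \<subseteq> F" unfolding link_def by auto
  then have "finite (insert v ` link v F)" using assms finite_subset by blast
  moreover have "inj_on (insert v) (link v F)" by (rule inj_on_insert) (simp add: link_def)
  ultimately show "finite (link v F)" by (rule finite_imageD)
  show "finite (deletion v F)" using assms unfolding deletion_def by simp
qed

lemma card_link_deletion:
  assumes "finite F"
  shows "card F = card (link v F) + card (deletion v F)"
proof -
  have "card F = card (deletion v F \<union> insert v ` link v F)"
    using link_deletion_decomposition[of F v] by simp
  also have "\<dots> = card (deletion v F) + card (insert v ` link v F)"
    using finite_link_deletion[OF assms, of v]
    by (intro card_Un_disjoint) (auto simp: deletion_def)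
  also have "card (insert v ` link v F) = card (link v F)"
    by (intro card_image inj_on_insert) (auto simp: link_def)
  finally show ?thesis by simp
qed

section \<open>Kruskal-Katona in interpolated form\<close>

text \<open>Each effective compression towards \<open>v\<close> lowers the number of members
  avoiding \<open>v\<close>, so the process stops. One target point suffices: the shadow of the
  members avoiding \<open>v\<close> then lies inside the link of \<open>v\<close>.\<close>

lemma compressed_family_exists:
  assumes V: "finite V" "v \<in> V" and "G \<subseteq> nsets V (Suc a)"
  shows "\<exists>H \<subseteq> nsets V (Suc a). card H = card G \<and> card (shadow H) \<le> card (shadow G) \<and>
           (\<forall>A\<in>H. \<forall>j\<in>A. v \<notin> A \<longrightarrow> insert v (A - {j}) \<in> H)"
  using assms(3)
proof (induction "card {A \<in> G. v \<notin> A}" arbitrary: G rule: less_induct)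
  case less
  have finG: "finite G" by (rule finite_family[OF V(1) less.prems])
  show ?case
  proof (cases "\<forall>A\<in>G. \<forall>j\<in>A. v \<notin> A \<longrightarrow> insert v (A - {j}) \<in> G")
    case True
    then show ?thesis using less.prems by (intro exI[of _ G]) simp
  next
    case False
    then obtain A j where A: "A \<in> G" "j \<in> A" "v \<notin> A" "insert v (A - {j}) \<notin> G" by blast
    let ?H = "shift v j G"
    have H: "?H \<subseteq> nsets V (Suc a)" by (rule shift_nsets[OF less.prems V(2)])
    have "{A \<in> ?H. v \<notin> A} \<subset> {A \<in> G. v \<notin> A}"
    proof
      show "{A \<in> ?H. v \<notin> A} \<subseteq> {A \<in> G. v \<notin> A}" by (auto simp: mem_shift)
      have "A \<notin> ?H" using A by (simp add: mem_shift)
      then show "{A \<in> ?H. v \<notin> A} \<noteq> {A \<in> G. v \<notin> A}" using A by blast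
    qed
    then have "card {A \<in> ?H. v \<notin> A} < card {A \<in> G. v \<notin> A}"
      using finG by (intro psubset_card_mono) auto
    from less.hyps[OF this H] obtain K where K: "K \<subseteq> nsets V (Suc a)" "card K = card ?H"
      "card (shadow K) \<le> card (shadow ?H)" "\<forall>A\<in>K. \<forall>j\<in>A. v \<notin> A \<longrightarrow> insert v (A - {j}) \<in> K"
      by (elim exE conjE)
    have fs: "finite (shadow G)"
      by (rule finite_family[OF V(1) shadow_nsets[OF less.prems]])
    have fss: "finite (shift v j (shadow G))"
      by (rule finite_family[OF V(1) shift_nsets[OF shadow_nsets[OF less.prems] V(2)]])
    have "card (shadow ?H) \<le> card (shift v j (shadow G))"
      using shadow_shift fss by (intro card_mono)
    also have "\<dots> = card (shadow G)" by (rule card_shift[OF fs])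
    finally have "card (shadow K) \<le> card (shadow G)" using K(3) by linarith
    then show ?thesis using K card_shift[OF finG, of v j] by (intro exI[of _ K]) simp
  qed
qed

text \<open>Lower index \<open>a - 1\<close>, with value 0 at \<open>a = 0\<close>, where truncated
  subtraction would give 1; this keeps Pascal's rule valid for every \<open>a\<close>.\<close>

definition choose_pred :: "nat \<Rightarrow> nat \<Rightarrow> nat" where
  "choose_pred n a = (case a of 0 \<Rightarrow> 0 | Suc b \<Rightarrow> n choose b)"

lemma choose_pred_simps [simp]: "choose_pred n 0 = 0" "choose_pred n (Suc a) = n choose a"
  by (simp_all add: choose_pred_def)

lemma choose_pred_pascal: "Suc n choose a = (n choose a) + choose_pred n a"
  by (cases a) auto

text \<open>The lower bound interpolates linearly between the points \<open>|G| = C(N,a+1)\<close> and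
  \<open>|G| = C(N+1,a+1)\<close> of Lovasz's form; unlike real binomial coefficients, the interpolation
  obeys Pascal's rule exactly.\<close>
theorem kruskal_katona_interpolated:
  assumes "finite V" "G \<subseteq> nsets V (Suc a)" "G \<noteq> {}" "a \<le> N" "0 \<le> \<sigma>" "\<sigma> \<le> 1"
    and "real (N choose Suc a) + \<sigma> * real (N choose a) \<le> real (card G)"
  shows "real (N choose a) + \<sigma> * real (choose_pred N a) \<le> real (card (shadow G))"
  using assms
proof (induction V arbitrary: G a N rule: finite_induct)
  case empty
  then show ?case by (auto simp: nsets_def)
next
  case (insert v V)
  have "finite (insert v V)" using insert by auto
  then obtain H where H: "H \<subseteq> nsets (insert v V) (Suc a)" "card H = card G"
      "card (shadow H) \<le> card (shadow G)"
      and comp: "\<And>A j. A \<in> H \<Longrightarrow> j \<in> A \<Longrightarrow> v \<notin> A \<Longrightarrow> insert v (A - {j}) \<in> H"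
    using compressed_family_exists[of "insert v V" v G a] insert.prems by blast
  have finH: "finite H" by (rule finite_family[OF \<open>finite (insert v V)\<close> H(1)])
  have finsH: "finite (shadow H)"
    by (rule finite_family[OF \<open>finite (insert v V)\<close> shadow_nsets[OF H(1)]])
  have "finite G" by (rule finite_family[OF \<open>finite (insert v V)\<close> insert.prems(1)])
  then have Hne: "H \<noteq> {}" using H(2) insert.prems(2) by auto
  define H1 where "H1 = link v H"
  define H0 where "H0 = deletion v H"
  have V: "insert v V - {v} = V" using insert.hyps by auto
  have H1: "H1 \<subseteq> nsets V a" using link_nsets[OF H(1), of v] V unfolding H1_def by simp
  have H0: "H0 \<subseteq> nsets V (Suc a)" using deletion_nsets[OF H(1), of v] V unfolding H0_def by simp
  have fin: "finite H1" "finite H0"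
    using finite_link_deletion[OF finH] unfolding H1_def H0_def by auto
  have cardH: "card H = card H0 + card H1"
    using card_link_deletion[OF finH, of v] unfolding H1_def H0_def by simp
  \<comment> \<open>This is what compression is for: a point removed from a member avoiding
    \<open>v\<close> may be replaced by \<open>v\<close>.\<close>
  have sub01: "shadow H0 \<subseteq> H1"
  proof
    fix A assume "A \<in> shadow H0"
    then obtain x where x: "x \<notin> A" "insert x A \<in> H" "v \<notin> insert x A"
      unfolding shadow_def H0_def deletion_def by blast
    have "insert v (insert x A - {x}) \<in> H" by (rule comp) (use x in auto)
    then show "A \<in> H1" using x unfolding H1_def link_def by auto
  qed
  have H1ne: "H1 \<noteq> {}"
  proof
    assume "H1 = {}"
    then obtain A where A: "A \<in> H0" using link_deletion_decomposition[of H v] Hne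
      unfolding H0_def H1_def by auto
    then have "card A = Suc a" using H0 unfolding nsets_def by auto
    then obtain x where "x \<in> A" by (metis card.empty nat.distinct(1) ex_in_conv)
    then have "A - {x} \<in> shadow H0" using A unfolding shadow_def
      by (auto intro!: exI[of _ x] simp: insert_absorb)
    then show False using sub01 \<open>H1 = {}\<close> by auto
  qed
  have disj: "H1 \<inter> insert v ` shadow H1 = {}" unfolding H1_def link_def by auto
  have v1: "v \<notin> A" if "A \<in> shadow H1" for A
    using that unfolding shadow_def H1_def link_def by auto
  \<comment> \<open>The shadow contains the link, by removing \<open>v\<close>, and the shadow of
    the link with \<open>v\<close> added; these two parts are disjoint.\<close>
  have "H1 \<union> insert v ` shadow H1 \<subseteq> shadow H"
    unfolding shadow_def H1_def link_def by (auto simp: insert_commute)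
  then have "card (H1 \<union> insert v ` shadow H1) \<le> card (shadow H)"
    using finsH by (intro card_mono)
  moreover have "card (insert v ` shadow H1) = card (shadow H1)"
    by (intro card_image inj_on_insert) (use v1 in auto)
  moreover have "finite (insert v ` shadow H1)"
    using \<open>H1 \<union> insert v ` shadow H1 \<subseteq> shadow H\<close> finsH finite_subset by blast
  ultimately have lower: "card H1 + card (shadow H1) \<le> card (shadow G)"
    using H(3) disj fin by (simp add: card_Un_disjoint)
  have pos: "card H1 \<ge> 1" using H1ne fin by (simp add: Suc_leI card_gt_0_iff)
  show ?case
  proof (cases a)
    case 0
    then show ?thesis using lower pos by auto
  next
    case (Suc c)
    then obtain M where M: "N = Suc M" "c \<le> M" using insert.prems by (cases N) auto
    \<comment> \<open>With \<open>N = M + 1\<close> Pascal's rule splits the threshold. If the link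
      reaches its share, induction applies to the link. Otherwise the deletion exceeds its own
      share, and induction on it makes the link large after all, a contradiction.\<close>
    show ?thesis
    proof (cases "real (M choose a) + \<sigma> * real (M choose c) \<le> real (card H1)")
      case True
      have "real (M choose c) + \<sigma> * real (choose_pred M c) \<le> real (card (shadow H1))"
        by (rule insert.IH) (use True H1 H1ne Suc M insert.prems in auto)
      moreover have "real (N choose a) = real (M choose a) + real (M choose c)"
        using Suc M by simp
      moreover have "\<sigma> * real (choose_pred N a) = \<sigma> * real (M choose c) + \<sigma> * real (choose_pred M c)"
        using Suc M by (simp add: choose_pred_pascal distrib_left)
      ultimately show ?thesis using lower True by linarith
    next
      case False
      have "\<sigma> * real (N choose a) = \<sigma> * real (M choose c) + \<sigma> * real (M choose a)"
        using Suc M by (simp add: distrib_left)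
      moreover have "real (N choose Suc a) = real (M choose a) + real (M choose Suc a)"
        using M by simp
      moreover have "real (card G) = real (card H0) + real (card H1)" using cardH H by simp
      ultimately have big: "real (M choose Suc a) + \<sigma> * real (M choose a) < real (card H0)"
        using insert.prems(6) False by linarith
      \<comment> \<open>At \<open>a = M + 1\<close> the threshold for the link is only
        \<open>\<sigma>\<close>, which a single member already reaches.\<close>
      have aM: "a \<le> M"
      proof (rule ccontr)
        assume "\<not> a \<le> M"
        then have "c = M" using Suc M by linarith
        then have "M choose a = 0" "M choose c = 1" using Suc by auto
        moreover have "\<sigma> \<le> real (card H1)" using pos insert.prems(5) by linarith
        ultimately show False using False by (simp add: binomial_eq_0)
      qed
      have "0 \<le> \<sigma> * real (M choose a)" using insert.prems by auto
      then have "H0 \<noteq> {}" using big by auto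
      then have "real (M choose a) + \<sigma> * real (choose_pred M a) \<le> real (card (shadow H0))"
        by (intro insert.IH) (use big H0 aM insert.prems in auto)
      also have "\<dots> \<le> real (card H1)" using sub01 fin by (simp add: card_mono)
      finally show ?thesis using False Suc by simp
    qed
  qed
qed

section \<open>Cross-intersecting families\<close>

text \<open>For a family of \<open>a\<close>-sets this is the \<open>(a - b)\<close>-fold shadow,
  given directly by subsets.\<close>

definition lower_shadow :: "nat \<Rightarrow> 'a set set \<Rightarrow> 'a set set" where
  "lower_shadow b G = (\<Union>A\<in>G. nsets A b)"

lemma lower_shadow_Suc:
  assumes "G \<subseteq> nsets V a" "b < a"
  shows "lower_shadow b G = shadow (lower_shadow (Suc b) G)"
proof
  show "lower_shadow b G \<subseteq> shadow (lower_shadow (Suc b) G)"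
  proof
    fix B assume "B \<in> lower_shadow b G"
    then obtain A where A: "A \<in> G" "B \<in> nsets A b" unfolding lower_shadow_def by blast
    then have "card A = a" "finite A" using assms by (auto simp: nsets_def)
    moreover have B: "card B = b" "B \<subseteq> A" "finite B" using A by (auto simp: nsets_def)
    ultimately have "B \<noteq> A" using assms by auto
    then obtain x where "x \<in> A" "x \<notin> B" using B by blast
    then have "x \<notin> B" "insert x B \<in> nsets A (Suc b)" using B by (auto simp: nsets_def)
    then show "B \<in> shadow (lower_shadow (Suc b) G)"
      using A unfolding shadow_def lower_shadow_def by blast
  qed
  show "shadow (lower_shadow (Suc b) G) \<subseteq> lower_shadow b G"
    unfolding shadow_def lower_shadow_def nsets_def by auto
qed

lemma lower_shadow_nsets: "G \<subseteq> nsets V a \<Longrightarrow> lower_shadow b G \<subseteq> nsets V b"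
  unfolding lower_shadow_def nsets_def by auto

lemma lower_shadow_nonempty:
  assumes "G \<subseteq> nsets V a" "G \<noteq> {}" "b \<le> a"
  shows "lower_shadow b G \<noteq> {}"
proof -
  obtain A where A: "A \<in> G" "card A = a" "finite A" using assms by (auto simp: nsets_def)
  obtain B where "B \<subseteq> A" "card B = b" "finite B"
    using obtain_subset_with_card_n[of b A] A assms(3) by metis
  then have "B \<in> lower_shadow b G" using A unfolding lower_shadow_def nsets_def by auto
  then show ?thesis by blast
qed

text \<open>The interpolated bound reproduces its own hypothesis one level down, with the same
  \<open>N\<close> and \<open>\<sigma>\<close>, so it can be iterated.\<close>

lemma lower_shadow_card_ge:
  assumes V: "finite V" and G: "G \<subseteq> nsets V a" "G \<noteq> {}" and "b \<le> a" "a \<le> Suc N"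
    and s: "0 \<le> \<sigma>" "\<sigma> \<le> 1"
    and le: "real (N choose a) + \<sigma> * real (choose_pred N a) \<le> real (card G)"
  shows "real (N choose b) + \<sigma> * real (choose_pred N b) \<le> real (card (lower_shadow b G))"
  using \<open>b \<le> a\<close>
proof (induction rule: inc_induct)
  case base
  have "nsets A a = {A}" if "A \<in> G" for A
  proof -
    have "card A = a" "finite A" using that G by (auto simp: nsets_def)
    then show ?thesis
      by (auto simp: nsets_def card_subset_eq dest: card_subset_eq[of A])
  qed
  then have "lower_shadow a G = G" unfolding lower_shadow_def by auto
  then show ?case using le by simp
next
  case (step b)
  have "real (N choose b) + \<sigma> * real (choose_pred N b)
      \<le> real (card (shadow (lower_shadow (Suc b) G)))"
    by (rule kruskal_katona_interpolated[OF V lower_shadow_nsets[OF G(1)]])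
       (use step lower_shadow_nonempty[OF G, of "Suc b"] s assms(5) in auto)
  then show ?case using lower_shadow_Suc[OF G(1) step(2)] by simp
qed

text \<open>An \<open>s\<close>-set inside the complement of a member of \<open>A\<close> misses
  that member and hence is not in \<open>B\<close>.\<close>

lemma cross_intersecting_lower_shadow:
  assumes W: "finite W" and A: "A \<subseteq> nsets W r" and B: "B \<subseteq> nsets W s"
    and cross: "\<forall>X\<in>A. \<forall>Y\<in>B. X \<inter> Y \<noteq> {}"
  shows "card B + card (lower_shadow s ((-) W ` A)) \<le> card W choose s"
proof -
  let ?L = "lower_shadow s ((-) W ` A)"
  have L: "?L \<subseteq> nsets W s" unfolding lower_shadow_def nsets_def by auto
  have "B \<inter> ?L = {}"
  proof (rule ccontr)
    assume "B \<inter> ?L \<noteq> {}"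
    then obtain X Y where "Y \<in> B" "X \<in> A" "Y \<subseteq> W - X"
      unfolding lower_shadow_def nsets_def by auto
    then show False using cross by blast
  qed
  moreover have "finite B" "finite ?L" using finite_family[OF W] B L by blast+
  ultimately have "card B + card ?L = card (B \<union> ?L)" by (simp add: card_Un_disjoint)
  also have "\<dots> \<le> card (nsets W s)"
    using B L W by (intro card_mono finite_imp_finite_nsets) auto
  also have "\<dots> = card W choose s" using W by simp
  finally show ?thesis .
qed

text \<open>Here \<open>a\<close> is the size of the complements of members of \<open>A\<close>;
  Kruskal-Katona counts the \<open>s\<close>-sets below them, all forbidden to
  \<open>B\<close>.\<close>

lemma cross_intersecting_card_le:
  assumes W: "finite W" and A: "A \<subseteq> nsets W r" "A \<noteq> {}" and B: "B \<subseteq> nsets W s"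
    and cross: "\<forall>X\<in>A. \<forall>Y\<in>B. X \<inter> Y \<noteq> {}"
    and a: "card W = r + a" "s \<le> a" "a \<le> Suc N" and \<sigma>: "0 \<le> \<sigma>" "\<sigma> \<le> 1"
    and le: "real (N choose a) + \<sigma> * real (choose_pred N a) \<le> real (card A)"
  shows "real (card B) + real (N choose s) + \<sigma> * real (choose_pred N s) \<le> real (card W choose s)"
proof -
  have "inj_on ((-) W) A"
    using A by (intro inj_on_inverseI[where g = "(-) W"]) (auto simp: nsets_def)
  then have c: "card ((-) W ` A) = card A" by (rule card_image)
  have G: "(-) W ` A \<subseteq> nsets W a"
    using A W a by (auto simp: nsets_def card_Diff_subset)
  have ne: "(-) W ` A \<noteq> {}" using A(2) by blast
  have "real (N choose s) + \<sigma> * real (choose_pred N s)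
      \<le> real (card (lower_shadow s ((-) W ` A)))"
    by (rule lower_shadow_card_ge[OF W G ne a(2,3) \<sigma>]) (use c le in simp)
  moreover have "card B + card (lower_shadow s ((-) W ` A)) \<le> card W choose s"
    by (rule cross_intersecting_lower_shadow[OF W A(1) B cross])
  then have "real (card B) + real (card (lower_shadow s ((-) W ` A))) \<le> real (card W choose s)"
    unfolding of_nat_add[symmetric] of_nat_le_iff .
  ultimately show ?thesis by linarith
qed

text \<open>For \<open>a <= m\<close> the quotient of C(m,a) by C(m,s) is C(m-s,a-s)/C(a,s), which
  grows with \<open>m\<close>.\<close>

lemma binomial_ratio_mono:
  assumes "s \<le> a" "m \<le> n"
  shows "(m choose a) * (n choose s) \<le> (m choose s) * (n choose a)"
proof (cases "a \<le> m")
  case True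
  have "(a choose s) * ((m choose a) * (n choose s))
      = (m choose s) * (n choose s) * ((m - s) choose (a - s))"
    using choose_mult[OF assms(1) True] by (simp add: algebra_simps)
  also have "\<dots> \<le> (m choose s) * (n choose s) * ((n - s) choose (a - s))"
    using assms by (intro mult_left_mono binomial_right_mono) auto
  also have "\<dots> = (a choose s) * ((m choose s) * (n choose a))"
    using choose_mult[of s a n] assms True by (simp add: algebra_simps)
  finally show ?thesis using assms by simp
qed (simp add: binomial_eq_0)

text \<open>A weighted form of the bound. At the nodes |A| = C(N,a) with \<open>N <= x\<close> it is
  Kruskal-Katona combined with \<open>binomial_ratio_mono\<close>, and between nodes both sides are
  linear.\<close>

lemma cross_intersecting_ratio:
  assumes W: "finite W" and A: "A \<subseteq> nsets W r" and B: "B \<subseteq> nsets W s"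
    and cross: "\<forall>X\<in>A. \<forall>Y\<in>B. X \<inter> Y \<noteq> {}"
    and a: "card W = r + a" "s \<le> a" "a \<le> x" and le: "card A \<le> x choose a"
  shows "card B * (x choose a) + card A * (x choose s) \<le> (card W choose s) * (x choose a)"
proof (cases "A = {}")
  case True
  have "card B \<le> card (nsets W s)"
    using B W by (intro card_mono finite_imp_finite_nsets) auto
  then show ?thesis using True W by simp
next
  case ne: False
  have "finite A" using finite_family[OF W A] .
  then have pos: "card A > 0" using ne by (simp add: card_gt_0_iff)
  obtain N \<sigma> where N: "a \<le> Suc N" "0 \<le> \<sigma>" "\<sigma> \<le> 1" "N \<le> x" "\<sigma> = 0 \<or> Suc N \<le> x"
    "real (card A) = real (N choose a) + \<sigma> * real (choose_pred N a)"
  proof (cases "card A = x choose a")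
    case True
    then show ?thesis using a by (intro that[of x 0]) auto
  next
    case False
    then have "card A < x choose a" using le by auto
    define M where "M = (LEAST M. card A < M choose a)"
    have M: "card A < M choose a" "M \<le> x"
      unfolding M_def using \<open>card A < x choose a\<close> by (auto intro: LeastI Least_le)
    then have "a \<le> M" by (metis not_less_zero binomial_eq_0 not_le)
    moreover have "M \<noteq> 0"
      using M(1) pos by (cases a; cases M) auto
    ultimately obtain N where N: "M = Suc N" "a \<le> Suc N" by (cases M) auto
    have "N choose a \<le> card A" using not_less_Least[of N "\<lambda>M. card A < M choose a"] N M_def by simp
    moreover have "card A < (N choose a) + choose_pred N a"
      using M N choose_pred_pascal by metis
    ultimately show ?thesis using N M
      by (intro that[of N "(real (card A) - real (N choose a)) / real (choose_pred N a)"])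
         (auto simp: field_simps)
  qed
  have ratio: "real (m choose a) * real (x choose s) \<le> real (m choose s) * real (x choose a)"
    if "m \<le> x" for m
    using binomial_ratio_mono[OF a(2) that] unfolding of_nat_mult[symmetric] of_nat_le_iff .
  \<comment> \<open>The interpolated value is a convex combination of the values at \<open>N\<close>
    and \<open>N + 1\<close>, so \<open>ratio\<close> can be used at both ends.\<close>
  have conv: "real (N choose b) + \<sigma> * real (choose_pred N b)
      = (1 - \<sigma>) * real (N choose b) + \<sigma> * real (Suc N choose b)" for b
    by (simp only: choose_pred_pascal) (simp add: algebra_simps)
  have "real (card A) * real (x choose s)
      = (1 - \<sigma>) * (real (N choose a) * real (x choose s)) + \<sigma> * (real (Suc N choose a) * real (x choose s))"
    by (simp only: N(6) conv) (simp only: algebra_simps)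
  also have "\<dots> \<le> (1 - \<sigma>) * (real (N choose s) * real (x choose a))
      + \<sigma> * (real (Suc N choose s) * real (x choose a))"
  proof (rule add_mono)
    show "(1 - \<sigma>) * (real (N choose a) * real (x choose s)) \<le> (1 - \<sigma>) * (real (N choose s) * real (x choose a))"
      using N(3) ratio[OF N(4)] by (intro mult_left_mono) auto
    show "\<sigma> * (real (Suc N choose a) * real (x choose s)) \<le> \<sigma> * (real (Suc N choose s) * real (x choose a))"
      using N(5)
    proof
      assume "Suc N \<le> x"
      from ratio[OF this] N(2) show ?thesis by (rule mult_left_mono)
    qed simp
  qed
  also have "\<dots> = (real (N choose s) + \<sigma> * real (choose_pred N s)) * real (x choose a)"
    by (simp only: conv) (simp only: algebra_simps)
  also have "\<dots> \<le> (real (card W choose s) - real (card B)) * real (x choose a)"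
    using cross_intersecting_card_le[OF W A ne B cross a(1,2) N(1-3)] N(6)
    by (intro mult_right_mono) auto
  finally have "real (card B * (x choose a) + card A * (x choose s))
      \<le> real ((card W choose s) * (x choose a))"
    by (simp add: algebra_simps)
  then show ?thesis by (simp only: of_nat_le_iff)
qed

text \<open>Since \<open>(a - 1) + (s - 1) = N\<close>, the increments C(N,a-1) and C(N,s-1) agree
  by symmetry. Hence the Kruskal-Katona bound on |A| + |B| is constant across the window and equals
  its value at |A| = C(N,a).\<close>

lemma cross_intersecting_window:
  assumes W: "finite W" and A: "A \<subseteq> nsets W r" "A \<noteq> {}" and B: "B \<subseteq> nsets W s"
    and cross: "\<forall>X\<in>A. \<forall>Y\<in>B. X \<inter> Y \<noteq> {}"
    and a: "card W = r + a" "s \<le> a" "1 \<le> s" "a + s = Suc (Suc N)"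
    and le: "N choose a \<le> card A" "card A \<le> Suc N choose a"
  shows "card A + card B + (N choose s) \<le> (card W choose s) + (N choose a)"
proof -
  have "choose_pred N a = N choose (a - 1)" "choose_pred N s = N choose (s - 1)"
    using a by (auto simp: choose_pred_def split: nat.splits)
  moreover have "N - (s - 1) = a - 1" "s - 1 \<le> N" using a by auto
  ultimately have sym: "choose_pred N a = choose_pred N s" "choose_pred N a > 0"
    using binomial_symmetric[of "s - 1" N] by auto
  define \<sigma> where "\<sigma> = (real (card A) - real (N choose a)) / real (choose_pred N a)"
  have eq: "\<sigma> * real (choose_pred N a) = real (card A) - real (N choose a)"
    unfolding \<sigma>_def using sym by simp
  have "card A \<le> (N choose a) + choose_pred N a" using le choose_pred_pascal by metis
  then have \<sigma>: "0 \<le> \<sigma>" "\<sigma> \<le> 1"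
    unfolding \<sigma>_def using le(1) sym(2) by (simp_all add: divide_simps)
  have "a \<le> Suc N" using a by linarith
  then have "real (card B) + real (N choose s) + \<sigma> * real (choose_pred N s) \<le> real (card W choose s)"
    by (rule cross_intersecting_card_le[OF W A B cross a(1,2) _ \<sigma>]) (simp add: eq)
  then show ?thesis using eq sym(1) by simp
qed

lemma binomial_choose_pred_symmetric: "l \<le> m \<Longrightarrow> m choose (Suc m - l) = choose_pred m l"
  using binomial_symmetric[of "l - 1" m] by (cases l) (auto simp: binomial_eq_0 Suc_diff_Suc)

text \<open>If the smaller family \<open>B\<close> reaches C(m+1,l), Kruskal-Katona bounds the
  larger one by C(m+1,l). Otherwise |B| lies between C(m,l-1) and C(m+1,l), the window for
  \<open>N = m\<close>, where the constant bound is 2 C(m+1,l).\<close>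

lemma cross_intersecting_pair_aux:
  assumes W: "finite W" "card W = Suc (Suc m)"
    and A: "A \<subseteq> nsets W (Suc l)" and B: "B \<subseteq> nsets W (Suc l)" and le: "card B \<le> card A"
    and cross: "\<forall>X\<in>B. \<forall>Y\<in>A. X \<inter> Y \<noteq> {}"
    and m: "2 * l \<le> m" and gt: "choose_pred m l < card B"
  shows "card A + card B \<le> 2 * (Suc m choose l)"
proof -
  have w: "card W = Suc l + (Suc m - l)" "Suc l \<le> Suc m - l" using W m by auto
  have ne: "B \<noteq> {}" using gt by auto
  have lm: "l \<le> m" using m by simp
  show ?thesis
  proof (cases "Suc m choose l \<le> card B")
    case True
    have "Suc m choose (Suc m - l) = Suc m choose l"
      using binomial_symmetric[of l "Suc m"] lm by simp
    then have "real (card A) + real (Suc m choose Suc l) + 0 * real (choose_pred (Suc m) (Suc l))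
        \<le> real (card W choose Suc l)"
      using True w by (intro cross_intersecting_card_le[OF W(1) B ne A cross w]) auto
    then have "card A + (Suc m choose Suc l) \<le> Suc (Suc m) choose Suc l" using W by simp
    then show ?thesis using le by simp
  next
    case False
    have "card B + card A + (m choose Suc l) \<le> (card W choose Suc l) + (m choose (Suc m - l))"
      by (rule cross_intersecting_window[OF W(1) B ne A cross w])
         (use False gt lm binomial_symmetric[of l "Suc m"] in
           \<open>auto simp: binomial_choose_pred_symmetric\<close>)
    moreover have "Suc m choose l = (m choose l) + choose_pred m l" by (rule choose_pred_pascal)
    ultimately show ?thesis using W lm by (simp add: binomial_choose_pred_symmetric)
  qed
qed

lemma cross_intersecting_pair:
  assumes W: "finite W" "card W = Suc (Suc m)"
    and A: "A \<subseteq> nsets W (Suc l)" and B: "B \<subseteq> nsets W (Suc l)"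
    and cross: "\<forall>X\<in>A. \<forall>Y\<in>B. X \<inter> Y \<noteq> {}"
    and m: "2 * l \<le> m" and gt: "choose_pred m l < card A" "choose_pred m l < card B"
  shows "card A + card B \<le> 2 * (Suc m choose l)"
proof -
  have cross': "\<forall>X\<in>B. \<forall>Y\<in>A. X \<inter> Y \<noteq> {}" using cross by blast
  show ?thesis
  proof (cases "card B \<le> card A")
    case True
    then show ?thesis by (rule cross_intersecting_pair_aux[OF W A B _ cross' m gt(2)])
  next
    case False
    then have "card A \<le> card B" by simp
    from cross_intersecting_pair_aux[OF W B A this cross m gt(1)] show ?thesis by simp
  qed
qed

section \<open>Intersecting families of large diversity\<close>

text \<open>From here on \<open>n = m + 4\<close> and \<open>k = l + 2\<close>. The family of all \<open>k\<close>-sets that meet a fixed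
  triple in at least two points has
  \<open>C(m+3,l+1) + C(m+1,l) - C(m+1,l+1)\<close> members, \<open>C(m+1,l)\<close> of which miss
  a given point of the triple.\<close>
lemma intersecting_card_le_of_shift_popular:
  assumes V: "finite V" "card V = Suc (Suc (Suc (Suc m)))" and ij: "i \<in> V" "j \<in> V" "i \<noteq> j"
    and F: "F \<subseteq> nsets V (Suc (Suc l))" and int: "intersecting F" and m: "2 * l + 2 \<le> m"
    and gt: "Suc m choose l < card (deletion i F)" "Suc m choose l < card (deletion j F)"
    and le: "card (deletion i (shift i j F)) \<le> Suc m choose l"
  shows "card F + (Suc m choose Suc l) \<le> (Suc (Suc (Suc m)) choose Suc l) + (Suc m choose l)"
proof -
  define W where "W = V - {i} - {j}"
  have W: "finite W" "card W = Suc (Suc m)" using V ij unfolding W_def by auto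
  have W': "W = V - {j} - {i}" unfolding W_def by auto
  \<comment> \<open>The four traces on the two points: both, \<open>i\<close> only, \<open>j\<close>
    only, neither.\<close>
  define F12 where "F12 = link i (link j F)"
  define F1 where "F1 = deletion j (link i F)"
  define F2 where "F2 = deletion i (link j F)"
  define F0 where "F0 = deletion i (deletion j F)"
  have sub: "F12 \<subseteq> nsets W l" "F1 \<subseteq> nsets W (Suc l)" "F2 \<subseteq> nsets W (Suc l)"
      "F0 \<subseteq> nsets W (Suc (Suc l))"
    using link_nsets[OF link_nsets[OF F, of j], of i] deletion_nsets[OF link_nsets[OF F, of i], of j]
      deletion_nsets[OF link_nsets[OF F, of j], of i] deletion_nsets[OF deletion_nsets[OF F, of j], of i]
    unfolding F12_def F1_def F2_def F0_def W'[symmetric] W_def[symmetric] by blast+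
  have finF: "finite F" by (rule finite_family[OF V(1) F])
  have fin: "finite (link x F)" "finite (deletion x F)" for x
    using finite_link_deletion[OF finF] by auto
  have swap: "link j (deletion i F) = F2" "link i (deletion j F) = F1" "deletion j (deletion i F) = F0"
    using ij(3) unfolding F1_def F2_def F0_def link_def deletion_def by auto
  have dj: "card (deletion j F) = card F1 + card F0"
    using card_link_deletion[OF fin(2)[of j], of i] swap by (simp add: F0_def)
  have di: "card (deletion i F) = card F2 + card F0"
    using card_link_deletion[OF fin(2)[of i], of j] swap by simp
  have lj: "card (link j F) = card F12 + card F2"
    using card_link_deletion[OF fin(1)[of j], of i] by (simp add: F12_def F2_def)
  have cardF: "card F = card F12 + card F1 + card F2 + card F0"
    using card_link_deletion[OF finF, of j] dj lj by simp
  let ?D = "deletion i (shift i j F)"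
  have "finite ?D"
    by (rule finite_link_deletion(2)[OF finite_family[OF V(1) shift_nsets[OF F ij(1)]]])
  then have "card ?D = card (link j ?D) + card (deletion j ?D)" by (rule card_link_deletion)
  \<comment> \<open>A set containing \<open>j\<close> but not \<open>i\<close> survives the shift
    only if its copy with \<open>i\<close> is also in \<open>F\<close>.\<close>
  moreover have "link j ?D = F1 \<inter> F2"
    using ij(3) unfolding F1_def F2_def link_def deletion_def
    by (auto simp: mem_shift insert_commute insert_Diff_if)
  moreover have "deletion j ?D = F0"
    unfolding F0_def deletion_def by (auto simp: mem_shift)
  ultimately have drop: "card (F1 \<inter> F2) + card F0 \<le> Suc m choose l" using le by simp
  have meet: "A \<inter> B \<noteq> {}" if "A \<in> F" "B \<in> F" for A B
    using int that unfolding intersecting_def by blast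
  have F0_F12: "\<forall>X\<in>F0. \<forall>Y\<in>F12. X \<inter> Y \<noteq> {}"
  proof (intro ballI)
    fix X Y assume "X \<in> F0" "Y \<in> F12"
    then show "X \<inter> Y \<noteq> {}"
      using meet[of X "insert j (insert i Y)"] unfolding F0_def F12_def link_def deletion_def by auto
  qed
  have F0_F1: "\<forall>X\<in>F0. \<forall>Y\<in>F1 \<union> F2. X \<inter> Y \<noteq> {}"
  proof (intro ballI)
    fix X Y assume "X \<in> F0" "Y \<in> F1 \<union> F2"
    then show "X \<inter> Y \<noteq> {}"
      using meet[of X "insert i Y"] meet[of X "insert j Y"]
      unfolding F0_def F1_def F2_def link_def deletion_def by auto
  qed
  have F1_F2: "\<forall>X\<in>F1. \<forall>Y\<in>F2. X \<inter> Y \<noteq> {}"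
  proof (intro ballI)
    fix X Y assume "X \<in> F1" "Y \<in> F2"
    then show "X \<inter> Y \<noteq> {}"
      using meet[of "insert i X" "insert j Y"] ij(3)
      unfolding F1_def F2_def link_def deletion_def by auto
  qed
  have w: "card W = Suc (Suc l) + (m - l)" "m choose (m - l) = m choose l"
    using W m binomial_symmetric[of l m] by auto
  \<comment> \<open>A large \<open>F0\<close> bounds \<open>F12\<close> and the union of
    \<open>F1\<close> and \<open>F2\<close> by Kruskal-Katona; \<open>drop\<close> controls what
    remains, \<open>F0\<close> and the overlap of \<open>F1\<close> and \<open>F2\<close>.\<close>
  show ?thesis
  proof (cases "m choose l \<le> card F0")
    case True
    have "0 < m choose l" using m by simp
    then have ne: "F0 \<noteq> {}" using True by auto
    have sub12: "F1 \<union> F2 \<subseteq> nsets W (Suc l)" using sub by blast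
    have "real (card (F1 \<union> F2)) + real (m choose Suc l) + 0 * real (choose_pred m (Suc l))
        \<le> real (card W choose Suc l)"
      by (rule cross_intersecting_card_le[OF W(1) sub(4) ne sub12 F0_F1 w(1)])
         (use True w m in auto)
    then have a: "card (F1 \<union> F2) + (m choose Suc l) \<le> Suc (Suc m) choose Suc l"
      using W by simp
    have "real (card F12) + real (m choose l) + 0 * real (choose_pred m l) \<le> real (card W choose l)"
      by (rule cross_intersecting_card_le[OF W(1) sub(4) ne sub(1) F0_F12 w(1)])
         (use True w m in auto)
    then have b: "card F12 + (m choose l) \<le> Suc (Suc m) choose l"
      using W by simp
    have "card F1 + card F2 = card (F1 \<union> F2) + card (F1 \<inter> F2)"
      using finite_family[OF W(1)] sub by (intro card_Un_Int) blast+
    then show ?thesis using a b drop cardF by simp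
  next
    case False
    \<comment> \<open>With upper index \<open>m\<close> the two weights coincide, which leaves a
      plain bound on |F12| + |F0|. A small \<open>F0\<close> also forces \<open>F1\<close> and
      \<open>F2\<close> above C(m,l-1), as \<open>cross_intersecting_pair\<close> requires.\<close>
    have "card F12 * (m choose (m - l)) + card F0 * (m choose l)
        \<le> (card W choose l) * (m choose (m - l))"
      by (rule cross_intersecting_ratio[OF W(1) sub(4) sub(1) F0_F12 w(1)])
         (use False w m in auto)
    then have "(card F12 + card F0) * (m choose l) \<le> (card W choose l) * (m choose l)"
      unfolding w(2) by (simp add: algebra_simps)
    then have a: "card F12 + card F0 \<le> Suc (Suc m) choose l"
      using W m by simp
    have "Suc m choose l = (m choose l) + choose_pred m l" by (rule choose_pred_pascal)
    then have "choose_pred m l < card F1" "choose_pred m l < card F2"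
      using gt di dj False by linarith+
    then have "card F1 + card F2 \<le> 2 * (Suc m choose l)"
      using m by (intro cross_intersecting_pair[OF W sub(2,3) F1_F2]) auto
    then show ?thesis using a cardF by simp
  qed
qed

section \<open>Shifted families: walks and first hits\<close>

text \<open>Read \<open>A\<close> as a walk stepping up at its elements and down elsewhere; the
  condition says that the walk is positive after \<open>p\<close> steps.\<close>

definition hits :: "nat \<Rightarrow> nat set \<Rightarrow> bool" where
  "hits p A \<longleftrightarrow> p < 2 * card (A \<inter> {1..p})"

definition first_hit :: "nat set \<Rightarrow> nat" where
  "first_hit A = (LEAST p. hits p A)"

lemma card_Int_Suc:
  "card (A \<inter> {1..Suc p}) = card (A \<inter> {1..p}) + (if Suc p \<in> A then 1 else 0)"
proof -
  have "A \<inter> {1..Suc p} = (if Suc p \<in> A then insert (Suc p) (A \<inter> {1..p}) else A \<inter> {1..p})"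
    by (auto simp: le_Suc_eq)
  then show ?thesis by simp
qed

text \<open>Otherwise one could shift \<open>A\<close> down, element by element, to a member disjoint from \<open>A\<close>.\<close>
lemma shifted_intersecting_hits:
  fixes F :: "nat set set"
  assumes F: "F \<subseteq> nsets {1..n} k" and int: "intersecting F" and A: "A \<in> F"
    and shifted: "\<And>i j B. 1 \<le> i \<Longrightarrow> i < j \<Longrightarrow> j \<le> n \<Longrightarrow> B \<in> F \<Longrightarrow> j \<in> B \<Longrightarrow> i \<notin> B
      \<Longrightarrow> insert i (B - {j}) \<in> F"
  shows "\<exists>p. hits p A"
proof (rule ccontr)
  assume "\<not> (\<exists>p. hits p A)"
  then have low: "2 * card (A \<inter> {1..p}) \<le> p" for p unfolding hits_def by (simp add: not_less)
  \<comment> \<open>Induction on the prefix already cleared: \<open>B\<close> is disjoint from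
    \<open>A\<close> there, has as many elements there as \<open>A\<close>, and agrees with
    \<open>A\<close> beyond it.\<close>
  have "\<exists>B\<in>F. A \<inter> B \<inter> {1..p} = {} \<and> B - {1..p} = A - {1..p} \<and>
      card (B \<inter> {1..p}) = card (A \<inter> {1..p})" if "p \<le> n" for p
    using that
  proof (induction p)
    case 0
    show ?case using A by (intro bexI[of _ A]) auto
  next
    case (Suc p)
    then obtain B where B: "B \<in> F" "A \<inter> B \<inter> {1..p} = {}" "B - {1..p} = A - {1..p}"
      "card (B \<inter> {1..p}) = card (A \<inter> {1..p})" by auto
    have same: "x \<in> B \<longleftrightarrow> x \<in> A" if "x \<notin> {1..p}" for x using B(3) that by blast
    show ?case
    proof (cases "Suc p \<in> A")
      case False
      have "Suc p \<notin> B" using False same[of "Suc p"] by simp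
      have "A \<inter> B \<inter> {1..Suc p} = {}"
        using B(2) False by (auto simp: le_Suc_eq)
      moreover have "B - {1..Suc p} = A - {1..Suc p}" using same by auto
      moreover have "card (B \<inter> {1..Suc p}) = card (A \<inter> {1..Suc p})"
        using B(4) False \<open>Suc p \<notin> B\<close> unfolding card_Int_Suc by simp
      ultimately show ?thesis using B(1) by blast
    next
      case True
      have SB: "Suc p \<in> B" using True same[of "Suc p"] by simp
      \<comment> \<open>As \<open>A\<close> contains \<open>p + 1\<close> without a hit there,
        \<open>A\<close> and \<open>B\<close> together leave a free point in \<open>{1..p}\<close>,
        to which \<open>p + 1\<close> can be shifted.\<close>
      have "card ((A \<union> B) \<inter> {1..p}) \<le> card (A \<inter> {1..p}) + card (B \<inter> {1..p})"
        by (simp only: Int_Un_distrib2 card_Un_le)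
      also have "\<dots> < p" using low[of "Suc p"] True B(4) unfolding card_Int_Suc by simp
      finally have "(A \<union> B) \<inter> {1..p} \<noteq> {1..p}" by auto
      then obtain y where y: "y \<in> {1..p}" "y \<notin> A" "y \<notin> B" by blast
      let ?B = "insert y (B - {Suc p})"
      have BF: "?B \<in> F" using y SB B(1) Suc.prems by (intro shifted) auto
      have "A \<inter> ?B \<inter> {1..Suc p} = {}"
        using B(2) y by (auto simp: le_Suc_eq)
      moreover have "?B - {1..Suc p} = A - {1..Suc p}" using same y by auto
      moreover have eq: "?B \<inter> {1..Suc p} = insert y (B \<inter> {1..p})" using y by auto
      have "card (?B \<inter> {1..Suc p}) = card (A \<inter> {1..Suc p})"
        unfolding eq card_Int_Suc using y B(4) True by simp
      ultimately show ?thesis using BF by blast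
    qed
  qed
  from this[of n] obtain B where B: "B \<in> F" "A \<inter> B \<inter> {1..n} = {}" by auto
  moreover have "A \<subseteq> {1..n}" using A F by (auto simp: nsets_def)
  ultimately have "A \<inter> B = {}" by blast
  then show False using int A B unfolding intersecting_def by blast
qed

text \<open>The walk moves by one, so it first becomes positive at height exactly 1; in particular
  first hits are odd.\<close>

lemma first_hit:
  assumes "\<exists>p. hits p A"
  shows "hits (first_hit A) A" "p < first_hit A \<Longrightarrow> 2 * card (A \<inter> {1..p}) \<le> p"
    "2 * card (A \<inter> {1..first_hit A}) = Suc (first_hit A)"
proof -
  show h: "hits (first_hit A) A" unfolding first_hit_def using assms by (rule LeastI_ex)
  show low: "2 * card (A \<inter> {1..p}) \<le> p" if "p < first_hit A" for p
    using not_less_Least that unfolding first_hit_def hits_def by (metis not_less)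
  show "2 * card (A \<inter> {1..first_hit A}) = Suc (first_hit A)"
  proof (cases "first_hit A")
    case 0
    then show ?thesis using h unfolding hits_def by simp
  next
    case (Suc p)
    have "2 * card (A \<inter> {1..p}) \<le> p" using low[of p] Suc by simp
    then show ?thesis
      using h[unfolded hits_def Suc card_Int_Suc] unfolding Suc card_Int_Suc
      by (simp split: if_splits)
  qed
qed

text \<open>First hits are odd, and a hit at 1 needs 1 as an element.\<close>

lemma first_hit_gt_1:
  assumes "\<exists>p. hits p A" "1 \<notin> A"
  shows "2 < first_hit A"
proof (rule ccontr)
  assume "\<not> 2 < first_hit A"
  then have "first_hit A = 1" using first_hit(3)[OF assms(1)] by presburger
  then show False using first_hit(3)[OF assms(1)] assms(2) by simp
qed

lemma diff_trace:
  fixes S :: "nat set"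
  assumes "G \<subseteq> nsets {1..n} k" "\<forall>B\<in>G. B \<inter> {1..p} = S"
  shows "inj_on (\<lambda>B. B - S) G" "(\<lambda>B. B - S) ` G \<subseteq> nsets {Suc p..n} (k - card S)"
proof -
  show "inj_on (\<lambda>B. B - S) G"
    by (rule inj_on_inverseI[where g = "\<lambda>B. B \<union> S"]) (use assms(2) in auto)
  show "(\<lambda>B. B - S) ` G \<subseteq> nsets {Suc p..n} (k - card S)"
  proof
    fix X assume "X \<in> (\<lambda>B. B - S) ` G"
    then obtain B where B: "B \<in> G" "X = B - S" by blast
    then have "S = B \<inter> {1..p}" "B \<subseteq> {1..n}" "finite B" "card B = k"
      using assms by (auto simp: nsets_def)
    moreover from this have "card (B - S) = k - card S"
      by (metis card_Diff_subset finite_Int inf_le1)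
    ultimately show "X \<in> nsets {Suc p..n} (k - card S)"
      using B(2) by (auto simp: nsets_def not_less_eq_eq)
  qed
qed

lemma card_nsets_with_trace:
  fixes S :: "nat set"
  assumes "S \<subseteq> {1..p}" "p \<le> n" "card S \<le> k"
  shows "card {C \<in> nsets {1..n} k. C \<inter> {1..p} = S} = (n - p) choose (k - card S)" (is "card ?N = _")
proof -
  have "bij_betw (\<lambda>B. B - S) ?N (nsets {Suc p..n} (k - card S))"
    unfolding bij_betw_def
  proof (intro conjI equalityI)
    show "inj_on (\<lambda>B. B - S) ?N" by (rule diff_trace) auto
    show "(\<lambda>B. B - S) ` ?N \<subseteq> nsets {Suc p..n} (k - card S)" by (rule diff_trace) auto
    show "nsets {Suc p..n} (k - card S) \<subseteq> (\<lambda>B. B - S) ` ?N"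
    proof
      fix X assume X: "X \<in> nsets {Suc p..n} (k - card S)"
      have "finite S" using assms(1) finite_subset by blast
      moreover have disj: "{Suc p..n} \<inter> {1..p} = {}" by auto
      then have "X \<inter> S = {}" using X assms(1) unfolding nsets_def by blast
      ultimately have "card (X \<union> S) = k" using X assms(3) by (simp add: card_Un_disjoint nsets_def)
      moreover have "X \<union> S \<subseteq> {1..n}"
      proof
        fix x assume "x \<in> X \<union> S"
        then have "x \<in> {Suc p..n} \<or> x \<in> {1..p}" using X assms(1) unfolding nsets_def by blast
        then show "x \<in> {1..n}" using assms(2) by auto
      qed
      moreover have "(X \<union> S) \<inter> {1..p} = S"
        using X assms(1) disj unfolding nsets_def by blast
      ultimately have "X \<union> S \<in> ?N" using \<open>finite S\<close> X by (auto simp: nsets_def)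
      moreover have "X = (X \<union> S) - S" using \<open>X \<inter> S = {}\<close> by auto
      ultimately show "X \<in> (\<lambda>B. B - S) ` ?N" by blast
    qed
  qed
  then have "card ?N = card (nsets {Suc p..n} (k - card S))" by (rule bij_betw_same_card)
  then show ?thesis by simp
qed

lemma binomial_diagonal_mono: "a choose b \<le> (a + d) choose (b + d)"
proof (induction d)
  case (Suc d)
  then show ?case by (simp add: trans_le_add1)
qed simp

text \<open>Exchanging the members with trace \<open>S\<close> on \<open>{1..p}\<close> for all \<open>k\<close>-sets with
  trace \<open>{1..p} - S\<close>: a set whose first hit is before \<open>p\<close> meets each new set inside
  \<open>{1..p}\<close> by pigeonhole, and one whose first hit is at \<open>p\<close> misses
  \<open>{1..p} - S\<close> only if its trace is \<open>S\<close>.\<close>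
lemma exchange_last_first_hit:
  assumes F: "F \<subseteq> nsets {1..n} k" and int: "intersecting F" and hit: "\<forall>B\<in>F. \<exists>p. hits p B"
    and A: "A \<in> F" "1 \<notin> A" and max: "\<forall>B\<in>F. 1 \<notin> B \<longrightarrow> first_hit B \<le> first_hit A"
    and n: "2 * k \<le> n"
  defines "p \<equiv> first_hit A"
  defines "S \<equiv> A \<inter> {1..p}"
  defines "FS \<equiv> {B \<in> F. B \<inter> {1..p} = S}"
  shows "\<exists>F' \<subseteq> nsets {1..n} k. intersecting F' \<and> (\<forall>B\<in>F'. \<exists>p. hits p B) \<and> card F \<le> card F' \<and>
    deletion 1 F' = deletion 1 F - FS" "FS \<subseteq> deletion 1 F" "card FS \<le> (n - p) choose (k - card S)"
    "p \<le> n" "card S \<le> k"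
proof -
  have hitA: "\<exists>p. hits p A" using hit A by blast
  have S2: "2 * card S = Suc p" unfolding S_def p_def by (rule first_hit(3)[OF hitA])
  \<comment> \<open>The odd number \<open>p = 2q + 1\<close> gives \<open>S\<close> exactly
    \<open>q + 1\<close> elements, and its complement \<open>T\<close> in \<open>{1..p}\<close>
    exactly \<open>q\<close>.\<close>
  then obtain q where q: "p = Suc (2 * q)" "card S = Suc q"
    by (cases "card S") auto
  have p2: "2 < p" unfolding p_def by (rule first_hit_gt_1[OF hitA A(2)])
  define T where "T = {1..p} - S"
  have ST: "S \<subseteq> {1..p}" "T \<subseteq> {1..p}" "finite S" unfolding S_def T_def by auto
  have cardT: "card T = q" unfolding T_def using ST q by (simp add: card_Diff_subset)
  have one: "1 \<notin> S" "1 \<in> T" using A(2) p2 unfolding S_def T_def by auto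
  have Ak: "finite A" "card A = k" "A \<subseteq> {1..n}" using A F by (auto simp: nsets_def)
  show qk': "card S \<le> k" using card_mono[of A S] Ak unfolding S_def by auto
  then have qk: "Suc q \<le> k" using q by simp
  show pn: "p \<le> n"
  proof (rule ccontr)
    assume "\<not> p \<le> n"
    then have "S = A" using Ak unfolding S_def by auto
    then show False using S2 Ak n \<open>\<not> p \<le> n\<close> by simp
  qed
  \<comment> \<open>Members with trace \<open>T\<close> already belong to the new block
    \<open>N\<close>. With traces removed they cross-intersect \<open>FS\<close>, so
    \<open>N\<close> adds at least as many sets as \<open>FS\<close> loses.\<close>
  define FT where "FT = {B \<in> F. B \<inter> {1..p} = T}"
  define N where "N = {C \<in> nsets {1..n} k. C \<inter> {1..p} = T}"
  define W where "W = {Suc p..n}"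
  have finF: "finite F" by (rule finite_family[OF _ F]) simp
  have finN: "finite N" unfolding N_def by (rule finite_family[of "{1..n}" _ k]) auto
  have cardN: "card N = (n - p) choose (k - q)"
    unfolding N_def using card_nsets_with_trace[OF ST(2) pn, of k] cardT qk by simp
  have FS: "FS \<subseteq> nsets {1..n} k" "\<forall>B\<in>FS. B \<inter> {1..p} = S" using F unfolding FS_def by auto
  have FT: "FT \<subseteq> nsets {1..n} k" "\<forall>B\<in>FT. B \<inter> {1..p} = T" using F unfolding FT_def by auto
  define FS' where "FS' = (\<lambda>B. B - S) ` FS"
  define FT' where "FT' = (\<lambda>B. B - T) ` FT"
  have FS': "FS' \<subseteq> nsets W (k - Suc q)" "card FS' = card FS"
    using diff_trace[OF FS] q unfolding FS'_def W_def by (auto intro: card_image)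
  have FT': "FT' \<subseteq> nsets W (k - q)" "card FT' = card FT"
    using diff_trace[OF FT] cardT unfolding FT'_def W_def by (auto intro: card_image)
  have cross: "\<forall>X\<in>FS'. \<forall>Y\<in>FT'. X \<inter> Y \<noteq> {}"
  proof (intro ballI)
    fix X Y assume "X \<in> FS'" "Y \<in> FT'"
    then obtain B C where BC: "B \<in> FS" "C \<in> FT" "X = B - S" "Y = C - T"
      unfolding FS'_def FT'_def by blast
    then have "B \<in> F" "C \<in> F" unfolding FS_def FT_def by auto
    then obtain x where x: "x \<in> B" "x \<in> C" using int unfolding intersecting_def by blast
    have "B \<inter> {1..p} = S" "C \<inter> {1..p} = T" using BC FS FT by auto
    then have "x \<notin> S" "x \<notin> T" using x ST unfolding T_def by blast+
    then show "X \<inter> Y \<noteq> {}" using x BC by auto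
  qed
  have finW: "finite W" unfolding W_def by simp
  have "card FS' \<le> card (nsets W (k - Suc q))"
    using FS' finW by (intro card_mono finite_imp_finite_nsets) auto
  then have cFS: "card FS \<le> (n - p) choose (k - Suc q)"
    using FS'(2) unfolding W_def by simp
  then show "card FS \<le> (n - p) choose (k - card S)" using q by simp
  \<comment> \<open>The assumption \<open>2 * k <= n\<close> gives \<open>k - q <= a\<close>. With
    upper index \<open>a + (k - q)\<close> the two binomial weights agree by symmetry, so the ratio
    bound becomes |FT| + |FS| <= |N|.\<close>
  define a where "a = n - p - (k - Suc q)"
  have a: "card W = (k - Suc q) + a" "k - q \<le> a" "a \<le> a + (k - q)"
    using n q qk pn unfolding W_def a_def by auto
  have np: "n - p = (k - Suc q) + a" using a unfolding W_def by simp
  have sym: "a + (k - q) choose a = a + (k - q) choose (k - q)"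
    using binomial_symmetric[of a "a + (k - q)"] by simp
  have "(n - p) choose (k - Suc q) = (n - p) choose a"
    using binomial_symmetric[of a "n - p"] np by simp
  also have "\<dots> \<le> a + (k - q) choose a" using np by (intro binomial_right_mono) auto
  finally have "card FS' \<le> a + (k - q) choose a" using cFS FS'(2) by simp
  from cross_intersecting_ratio[OF finW FS'(1) FT'(1) cross a this]
  have "(card FT + card FS) * (a + (k - q) choose a) \<le> card N * (a + (k - q) choose a)"
    unfolding sym FS' FT' cardN by (simp add: W_def algebra_simps)
  moreover have "0 < a + (k - q) choose a" by simp
  ultimately have exch: "card FT + card FS \<le> card N" by simp
  have FSdel: "FS \<subseteq> deletion 1 F" using one p2 unfolding FS_def deletion_def by auto
  then show "FS \<subseteq> deletion 1 F" .
  have disjST: "FS \<inter> FT = {}" using one unfolding FS_def FT_def by auto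
  define F' where "F' = (F - FS) \<union> N"
  have "F' \<subseteq> nsets {1..n} k" using F unfolding F'_def N_def by auto
  moreover have "card F \<le> card F'"
  proof -
    have eq: "F' = (F - (FS \<union> FT)) \<union> N" using F unfolding F'_def N_def FT_def by auto
    have "(F - (FS \<union> FT)) \<inter> N = {}" unfolding N_def FT_def by auto
    then have "card F' = card (F - (FS \<union> FT)) + card N"
      unfolding eq using finF finN by (intro card_Un_disjoint) auto
    moreover have sub: "FS \<union> FT \<subseteq> F" unfolding FS_def FT_def by auto
    moreover have "card (FS \<union> FT) = card FS + card FT"
      using disjST sub finF by (intro card_Un_disjoint) (auto intro: finite_subset)
    moreover have "card F = card (F - (FS \<union> FT)) + card (FS \<union> FT)"
      using sub finF by (metis card_Diff_subset card_mono finite_subset le_add_diff_inverse2)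
    ultimately show ?thesis using exch by linarith
  qed
  moreover have oneN: "1 \<in> C" if "C \<in> N" for C using that one unfolding N_def by blast
  have "deletion 1 F' = deletion 1 F - FS"
    using oneN unfolding F'_def deletion_def by auto
  moreover have "\<exists>p. hits p B" if "B \<in> F'" for B
  proof (cases "B \<in> F")
    case False
    then have "1 \<in> B" using that oneN unfolding F'_def by auto
    then have "B \<inter> {1..1} = {1}" by auto
    then have "hits 1 B" unfolding hits_def by simp
    then show ?thesis by blast
  qed (use hit in auto)
  moreover have "intersecting F'"
  proof -
    have new: "B \<inter> C \<noteq> {}" if B: "B \<in> F" "B \<notin> FS" and C: "C \<in> N" for B C
    proof (cases "1 \<in> B")
      case True
      then show ?thesis using oneN[OF C] by blast
    next
      case False
      have hB: "\<exists>p. hits p B" using hit B by blast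
      define p' where "p' = first_hit B"
      have "p' \<le> p" using max B False unfolding p'_def p_def by blast
      have CT: "C \<inter> {1..p} = T" using C unfolding N_def by auto
      show ?thesis
      proof (cases "p' = p")
        case True
        show ?thesis
        proof
          assume "B \<inter> C = {}"
          then have "B \<inter> {1..p} \<subseteq> S" using CT unfolding T_def by blast
          moreover have "card (B \<inter> {1..p}) = card S"
            using first_hit(3)[OF hB] S2 True unfolding p'_def by simp
          ultimately have "B \<inter> {1..p} = S" using ST(3) card_subset_eq by blast
          then show False using B unfolding FS_def by blast
        qed
      next
        case False
        then have lt: "p' < p" using \<open>p' \<le> p\<close> by simp
        have "C \<inter> {1..p'} = (C \<inter> {1..p}) \<inter> {1..p'}" using lt by auto
        also have "\<dots> = {1..p'} - (A \<inter> {1..p'})" unfolding CT T_def S_def using lt by auto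
        finally have "C \<inter> {1..p'} = {1..p'} - (A \<inter> {1..p'})" .
        then have "card (C \<inter> {1..p'}) = p' - card (A \<inter> {1..p'})"
          by (simp add: card_Diff_subset)
        moreover have "2 * card (A \<inter> {1..p'}) \<le> p'"
          using first_hit(2)[OF hitA] lt unfolding p_def by blast
        moreover have "p' < 2 * card (B \<inter> {1..p'})"
          using first_hit(1)[OF hB] unfolding hits_def p'_def .
        ultimately have big: "p' < card (B \<inter> {1..p'}) + card (C \<inter> {1..p'})" by linarith
        show ?thesis
        proof
          assume "B \<inter> C = {}"
          then have "card (B \<inter> {1..p'}) + card (C \<inter> {1..p'}) = card (B \<inter> {1..p'} \<union> C \<inter> {1..p'})"
            by (intro card_Un_disjoint[symmetric]) auto
          also have "\<dots> \<le> card {1..p'}" by (intro card_mono) auto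
          finally show False using big by simp
        qed
      qed
    qed
    show ?thesis
      unfolding intersecting_def
    proof (intro ballI)
      fix B C assume "B \<in> F'" "C \<in> F'"
      then consider "B \<in> F" "C \<in> F" | "B \<in> F" "B \<notin> FS" "C \<in> N" | "C \<in> F" "C \<notin> FS" "B \<in> N" |
        "B \<in> N" "C \<in> N" unfolding F'_def by blast
      then show "B \<inter> C \<noteq> {}"
      proof cases
        case 1
        then show ?thesis using int unfolding intersecting_def by blast
      next
        case 2
        then show ?thesis by (rule new)
      next
        case 3
        then have "C \<inter> B \<noteq> {}" by (rule new)
        then show ?thesis by blast
      next
        case 4
        then show ?thesis using oneN by blast
      qed
    qed
  qed
  ultimately show "\<exists>F' \<subseteq> nsets {1..n} k. intersecting F' \<and> (\<forall>B\<in>F'. \<exists>p. hits p B) \<and> card F \<le> card F' \<and>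
    deletion 1 F' = deletion 1 F - FS" by (intro exI[of _ F']) simp
qed

text \<open>Exchanges lower the diversity at 1 but not the size. Each removes at most C(m,l) =
  C(m+1,l) - C(m,l-1) members missing 1, so the first diversity not above C(m+1,l) falls into the
  range of \<open>cross_intersecting_window\<close>.\<close>

lemma intersecting_card_le_of_hits:
  assumes "F \<subseteq> nsets {1..Suc (Suc (Suc (Suc m)))} (Suc (Suc l))" "intersecting F"
    "\<forall>B\<in>F. \<exists>p. hits p B" "Suc m choose l < card (deletion 1 F)" "2 * l + 2 \<le> m"
  shows "card F + (Suc m choose Suc l) \<le> (Suc (Suc (Suc m)) choose Suc l) + (Suc m choose l)"
  using assms(1-4)
proof (induction "card (deletion 1 F)" arbitrary: F rule: less_induct)
  case less
  let ?n = "Suc (Suc (Suc (Suc m)))" and ?k = "Suc (Suc l)"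
  let ?G = "deletion 1 F"
  have finF: "finite F" by (rule finite_family[OF _ less.prems(1)]) simp
  have finG: "finite ?G" by (rule finite_link_deletion(2)[OF finF])
  have "?G \<noteq> {}" using less.prems(4) by auto
  then have "Max (first_hit ` ?G) \<in> first_hit ` ?G" using finG by (intro Max_in) auto
  then obtain A where A: "A \<in> ?G" "first_hit A = Max (first_hit ` ?G)" by auto
  have AF: "A \<in> F" "1 \<notin> A" using A unfolding deletion_def by auto
  have max: "\<forall>B\<in>F. 1 \<notin> B \<longrightarrow> first_hit B \<le> first_hit A"
    unfolding A(2) using finG by (auto intro!: Max_ge simp: deletion_def)
  define p where "p = first_hit A"
  define S where "S = A \<inter> {1..p}"
  define FS where "FS = {B \<in> F. B \<inter> {1..p} = S}"
  have n: "2 * ?k \<le> ?n" using assms(5) by simp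
  note ex = exchange_last_first_hit[OF less.prems(1-3) AF max n, folded p_def, folded S_def, folded FS_def]
  have hitA: "\<exists>p. hits p A" using less.prems(3) AF by blast
  have S2: "2 * card S = Suc p" unfolding S_def p_def by (rule first_hit(3)[OF hitA])
  \<comment> \<open>If the latest first hit were 3, all members missing 1 would contain 2 and 3, and
    there would be at most C(m+1,l) of them.\<close>
  have p3: "3 < p"
  proof (rule ccontr)
    assume np: "\<not> 3 < p"
    have "?G \<subseteq> (\<lambda>X. X \<union> {2, 3}) ` nsets {4..?n} l"
    proof
      fix B assume B: "B \<in> ?G"
      then have BF: "B \<in> F" "1 \<notin> B" unfolding deletion_def by auto
      have hB: "\<exists>p. hits p B" using BF less.prems(3) by blast
      have "first_hit B \<le> 3" using max BF np unfolding p_def by force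
      then have f3: "first_hit B = 3" using first_hit_gt_1[OF hB BF(2)] by simp
      have "2 * card (B \<inter> {1..3}) = 4" using first_hit(3)[OF hB] f3 by simp
      then have "card (B \<inter> {1..3}) = card {2, 3::nat}" by simp
      moreover have "B \<inter> {1..3} \<subseteq> {2, 3}"
      proof
        fix x assume "x \<in> B \<inter> {1..3}"
        then have "x \<noteq> 1" "1 \<le> x" "x \<le> 3" using BF(2) by auto
        then show "x \<in> {2, 3}" by auto
      qed
      ultimately have eq: "B \<inter> {1..3} = {2, 3}" by (intro card_subset_eq) auto
      have Bn: "B \<subseteq> {1..?n}" "finite B" "card B = ?k"
        using BF less.prems(1) by (auto simp: nsets_def)
      have "2 \<in> B" "3 \<in> B" using eq by auto
      then have "B = (B - {2, 3}) \<union> {2, 3}" by auto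
      moreover have "card (B - {2, 3}) = l"
        using Bn \<open>2 \<in> B\<close> \<open>3 \<in> B\<close> by (simp add: card_Diff_subset)
      moreover have "B - {2, 3} \<subseteq> {4..?n}"
      proof
        fix x assume x: "x \<in> B - {2, 3}"
        then have "x \<notin> {1..3}" using eq by blast
        moreover have "1 \<le> x" "x \<le> ?n" using x Bn(1) by auto
        ultimately show "x \<in> {4..?n}" by auto
      qed
      ultimately show "B \<in> (\<lambda>X. X \<union> {2, 3}) ` nsets {4..?n} l"
        using Bn(2) by (auto simp: nsets_def)
    qed
    then have "card ?G \<le> card ((\<lambda>X. X \<union> {2, 3}) ` nsets {4..?n} l)"
      by (intro card_mono) (auto intro: finite_imp_finite_nsets)
    also have "\<dots> \<le> card (nsets {4..?n} l)"
      by (intro card_image_le finite_imp_finite_nsets) simp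
    also have "\<dots> = Suc m choose l" by simp
    finally show False using less.prems(4) by simp
  qed
  obtain F' where F': "F' \<subseteq> nsets {1..?n} ?k" "intersecting F'" "\<forall>B\<in>F'. \<exists>p. hits p B"
    "card F \<le> card F'" "deletion 1 F' = ?G - FS" using ex(1) by (elim exE conjE)
  have "A \<in> FS" using AF unfolding FS_def S_def by simp
  have finFS: "finite FS" using finF unfolding FS_def by simp
  then have posFS: "0 < card FS" using \<open>A \<in> FS\<close> by (auto simp: card_gt_0_iff)
  have cG: "card ?G = card (deletion 1 F') + card FS"
    unfolding F'(5) using card_Diff_subset[OF finFS ex(2)] card_mono[OF finG ex(2)] by simp
  obtain q where q: "card S = Suc (Suc (Suc q))" "p = 2 * q + 5"
    using S2 p3 by (intro that[of "card S - 3"]) auto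
  \<comment> \<open>Raising both indices by \<open>q + 1\<close> turns the lower one into
    \<open>l\<close> and the upper one into \<open>m - q\<close>.\<close>
  have "card FS \<le> (?n - p) choose (?k - card S)" by (rule ex(3))
  also have "\<dots> \<le> ((?n - p) + Suc q) choose ((?k - card S) + Suc q)" by (rule binomial_diagonal_mono)
  also have "(?k - card S) + Suc q = l" using ex(5) q by simp
  also have "((?n - p) + Suc q) choose l \<le> m choose l"
    using ex(4) q by (intro binomial_right_mono) auto
  finally have small: "card FS \<le> m choose l" .
  show ?case
  proof (cases "Suc m choose l < card (deletion 1 F')")
    case True
    have "card (deletion 1 F') < card ?G" using cG posFS by simp
    from less.hyps[OF this F'(1-3) True] show ?thesis using F'(4) by simp
  next
    case False
    let ?D = "deletion 1 F'" and ?W = "{1..?n} - {1::nat}"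
    have finF': "finite F'" by (rule finite_family[OF _ F'(1)]) simp
    have lm: "l \<le> m" using assms(5) by simp
    have pascal: "Suc m choose l = (m choose l) + choose_pred m l" by (rule choose_pred_pascal)
    have D: "choose_pred m l < card ?D" using cG small less.prems(4) pascal by linarith
    then have ne: "?D \<noteq> {}" by auto
    have cross: "\<forall>X\<in>?D. \<forall>Y\<in>link 1 F'. X \<inter> Y \<noteq> {}"
    proof (intro ballI)
      fix X Y assume XY: "X \<in> ?D" "Y \<in> link 1 F'"
      then have "X \<inter> insert 1 Y \<noteq> {}"
        using F'(2) unfolding deletion_def link_def intersecting_def by blast
      then show "X \<inter> Y \<noteq> {}" using XY(1) unfolding deletion_def by auto
    qed
    have W: "card ?W = Suc (Suc (Suc m))" by simp
    have w: "card ?W = ?k + (Suc m - l)" "Suc l \<le> Suc m - l" "1 \<le> Suc l"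
        "(Suc m - l) + Suc l = Suc (Suc m)" "finite ?W"
      using assms(5) unfolding W by auto
    \<comment> \<open>The window with \<open>N = m\<close>, \<open>s = l + 1\<close> and
      \<open>a = m + 1 - l\<close>; adding C(m,l) to both sides then yields the claim.\<close>
    have "card ?D + card (link 1 F') + (m choose Suc l)
        \<le> (card ?W choose Suc l) + (m choose (Suc m - l))"
      by (rule cross_intersecting_window[OF w(5) deletion_nsets[OF F'(1)] ne link_nsets[OF F'(1)] cross w(1-4)])
         (use False D lm binomial_symmetric[of l "Suc m"] in
           \<open>auto simp: binomial_choose_pred_symmetric\<close>)
    then have "card F' + (m choose Suc l) \<le> (Suc (Suc (Suc m)) choose Suc l) + choose_pred m l"
      using card_link_deletion[OF finF', of 1] lm W
      by (simp only: binomial_choose_pred_symmetric add.commute)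
    then show ?thesis using F'(4) pascal by simp
  qed
qed

section \<open>Reduction to shifted families\<close>

text \<open>The termination measure for shifting: each moved member trades \<open>j\<close> for the
  smaller \<open>i\<close>.\<close>

lemma sum_shift_less:
  fixes F :: "nat set set"
  assumes "finite F" "\<forall>A\<in>F. finite A" "i < j" "shift i j F \<noteq> F"
  shows "(\<Sum>A\<in>shift i j F. \<Sum>A) < (\<Sum>A\<in>F. \<Sum>A)"
proof -
  define f where "f = (\<lambda>A. insert i (A - {j}))"
  define M where "M = {A \<in> F. j \<in> A \<and> i \<notin> A \<and> f A \<notin> F}"
  note dec = shift_decomposition[OF f_def M_def]
  have finM: "finite M" "M \<subseteq> F" using assms(1) unfolding M_def by auto
  have ne: "M \<noteq> {}"
  proof
    assume "M = {}"
    then show False using dec(1) assms(4) by simp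
  qed
  have lt: "\<Sum>(f A) < \<Sum>A" if "A \<in> M" for A
  proof -
    have A: "finite A" "j \<in> A" "i \<notin> A" using that assms(2) unfolding M_def by auto
    then have "\<Sum>A = j + \<Sum>(A - {j})" by (simp add: sum.remove)
    moreover have "\<Sum>(f A) = i + \<Sum>(A - {j})" using A unfolding f_def by simp
    ultimately show ?thesis using assms(3) by simp
  qed
  have "(\<Sum>A\<in>shift i j F. \<Sum>A) = (\<Sum>A\<in>F - M. \<Sum>A) + (\<Sum>A\<in>f ` M. \<Sum>A)"
    unfolding dec(1) using assms(1) finM dec(3) by (intro sum.union_disjoint) auto
  also have "(\<Sum>A\<in>f ` M. \<Sum>A) = (\<Sum>A\<in>M. \<Sum>(f A))"
    using sum.reindex[OF dec(2)] by simp
  also have "\<dots> < (\<Sum>A\<in>M. \<Sum>A)" using finM(1) ne lt by (intro sum_strict_mono) auto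
  also have "(\<Sum>A\<in>F - M. \<Sum>A) + (\<Sum>A\<in>M. \<Sum>A) = (\<Sum>A\<in>F. \<Sum>A)"
    using sum.subset_diff[OF finM(2) assms(1), of "\<Sum>"] by simp
  finally show ?thesis by simp
qed

text \<open>Members missing \<open>j\<close> all stay, and for \<open>x\<close> other than
  \<open>i\<close> and \<open>j\<close> the shift commutes with the deletion. So only the diversity
  at \<open>i\<close> can drop.\<close>

lemma card_deletion_shift_ge:
  assumes "finite F" "x \<noteq> i"
  shows "card (deletion x F) \<le> card (deletion x (shift i j F))"
proof (cases "x = j")
  case True
  have "finite (shift i j F)"
    unfolding shift_decomposition(1)[OF refl refl] using assms(1) by auto
  moreover have "deletion j F \<subseteq> deletion j (shift i j F)"
    unfolding deletion_def by (auto simp: mem_shift)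
  ultimately show ?thesis
    unfolding True by (intro card_mono finite_link_deletion)
next
  case False
  then have "deletion x (shift i j F) = shift i j (deletion x F)"
    using assms(2) unfolding deletion_def by (auto simp: mem_shift)
  then show ?thesis using card_shift finite_link_deletion(2)[OF assms(1)] by (metis order_refl)
qed

text \<open>Shifts are made while all diversities stay large. A shift that breaks this does so at
  \<open>i\<close>, which \<open>intersecting_card_le_of_shift_popular\<close> covers; if no shift
  changes the family, the first-hit argument applies.\<close>

theorem intersecting_card_le_of_large_deletions:
  assumes "F \<subseteq> nsets {1..Suc (Suc (Suc (Suc m)))} (Suc (Suc l))" "intersecting F"
    "2 * l + 2 \<le> m"
    "\<forall>i\<in>{1..Suc (Suc (Suc (Suc m)))}. Suc m choose l < card (deletion i F)"
  shows "card F + (Suc m choose Suc l) \<le> (Suc (Suc (Suc m)) choose Suc l) + (Suc m choose l)"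
  using assms(1,2,4)
proof (induction "\<Sum>A\<in>F. \<Sum>A" arbitrary: F rule: less_induct)
  case less
  let ?n = "Suc (Suc (Suc (Suc m)))" and ?k = "Suc (Suc l)"
  have finF: "finite F" by (rule finite_family[OF _ less.prems(1)]) simp
  have finA: "\<forall>A\<in>F. finite A" using less.prems(1) by (auto simp: nsets_def)
  show ?case
  proof (cases "\<exists>i j. 1 \<le> i \<and> i < j \<and> j \<le> ?n \<and> shift i j F \<noteq> F")
    case True
    then obtain i j where ij: "1 \<le> i" "i < j" "j \<le> ?n" "shift i j F \<noteq> F" by blast
    then have iV: "i \<in> {1..?n}" "j \<in> {1..?n}" "i \<noteq> j" by auto
    show ?thesis
    proof (cases "\<forall>x\<in>{1..?n}. Suc m choose l < card (deletion x (shift i j F))")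
      case True
      from less.hyps[OF sum_shift_less[OF finF finA ij(2,4)] shift_nsets[OF less.prems(1) iV(1)]
          intersecting_shift[OF less.prems(2)] True]
      show ?thesis using card_shift[OF finF, of i j] by simp
    next
      case False
      then obtain x where x: "x \<in> {1..?n}" "card (deletion x (shift i j F)) \<le> Suc m choose l"
        by (auto simp: not_less)
      have "x = i"
      proof (rule ccontr)
        assume "x \<noteq> i"
        from card_deletion_shift_ge[OF finF this, of j] less.prems(3) x show False by force
      qed
      then show ?thesis
        using x iV less.prems(3)
        by (intro intersecting_card_le_of_shift_popular[OF _ _ iV less.prems(1,2) assms(3)]) auto
    qed
  next
    case False
    have "\<exists>p. hits p A" if A: "A \<in> F" for A
    proof (rule shifted_intersecting_hits[OF less.prems(1,2) A])
      fix i j B assume *: "1 \<le> i" "i < j" "j \<le> ?n" "B \<in> F" "j \<in> B" "i \<notin> B"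
      then have "B \<in> shift i j F" using False by auto
      then show "insert i (B - {j}) \<in> F" using * by (simp add: mem_shift)
    qed
    then show ?thesis
      using less.prems assms(3) by (intro intersecting_card_le_of_hits) auto
  qed
qed

section \<open>Averaging degrees\<close>

lemma sum_degree:
  assumes "finite F" "finite U" "\<forall>A\<in>F. finite A"
  shows "(\<Sum>S\<in>nsets U t. degree F S) = (\<Sum>A\<in>F. card (A \<inter> U) choose t)"
proof -
  have "(\<Sum>S\<in>nsets U t. degree F S) = (\<Sum>S\<in>nsets U t. \<Sum>A\<in>F. if S \<subseteq> A then 1 else 0)"
    unfolding degree_def using assms(1) by (simp add: sum.If_cases Int_def)
  also have "\<dots> = (\<Sum>A\<in>F. \<Sum>S\<in>nsets U t. if S \<subseteq> A then 1 else 0)" by (rule sum.swap)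
  also have "\<dots> = (\<Sum>A\<in>F. card (A \<inter> U) choose t)"
  proof (rule sum.cong[OF refl])
    fix A assume "A \<in> F"
    have "nsets U t \<inter> {S. S \<subseteq> A} = nsets (A \<inter> U) t" by (auto simp: nsets_def)
    then show "(\<Sum>S\<in>nsets U t. if S \<subseteq> A then 1 else 0) = card (A \<inter> U) choose t"
      using assms(2) finite_imp_finite_nsets[of U t] by (simp add: sum.If_cases)
  qed
  finally show ?thesis .
qed

text \<open>The set \<open>U\<close> averaged over is free: below it is the ground set without a
  point of small diversity, or the whole ground set.\<close>

lemma min_degree_average:
  assumes "finite V" "U \<subseteq> V" "finite F" "\<forall>A\<in>F. finite A"
  shows "(card U choose t) * min_degree V t F \<le> (\<Sum>A\<in>F. card (A \<inter> U) choose t)"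
proof -
  have finU: "finite U" using assms finite_subset by blast
  have "min_degree V t F \<le> degree F S" if "S \<in> nsets U t" for S
    unfolding min_degree_def using that assms(1) nsets_mono[OF assms(2), of t]
    by (intro Min_le finite_imageI finite_imp_finite_nsets) auto
  then have "card (nsets U t) * min_degree V t F \<le> (\<Sum>S\<in>nsets U t. degree F S)"
    using sum_bounded_below[of "nsets U t" "min_degree V t F" "degree F"] by simp
  then show ?thesis using sum_degree[OF assms(3) finU assms(4), of t] by simp
qed

lemma binomial_sub_ratio:
  assumes "t \<le> k"
  shows "real (Suc k choose t) * (real (Suc k) - real t) = real (Suc k) * real (k choose t)"
proof -
  have "(Suc k - t) * (Suc k choose t) = Suc k * (k choose t)"
    by (simp only: binomial_absorb_comp diff_Suc_1)
  then have "real (Suc k - t) * real (Suc k choose t) = real (Suc k) * real (k choose t)"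
    by (metis of_nat_mult)
  then show ?thesis using assms by (simp add: of_nat_diff mult.commute)
qed

text \<open>Relative to a member containing \<open>i\<close>, Kruskal-Katona gives one missing
  \<open>i\<close> the weight (n-k-1)/(k-1). Averaging over \<open>t\<close>-sets avoiding
  \<open>i\<close> gives it C(k,t)/C(k-1,t) = k/(k-t), which by \<open>num\<close> is no larger. The
  average is thus at most that of the full star at \<open>i\<close>.\<close>

lemma min_degree_le_of_small_deletion:
  assumes F: "F \<subseteq> nsets V (Suc (Suc l))" "intersecting F" and V: "finite V" "card V = Suc (Suc (Suc (Suc m)))"
    and i: "i \<in> V" and small: "card (deletion i F) \<le> Suc m choose l"
    and m: "2 * l + 2 \<le> m" and t: "t \<le> Suc l"
    and num: "(real l + 2) * (real l + 1) \<le> (real m + 1 - real l) * (real l + 2 - real t)"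
  shows "min_degree V t F \<le> (Suc (Suc (Suc m)) - t) choose (Suc l - t)"
proof -
  let ?W = "V - {i}" and ?A = "deletion i F" and ?B = "link i F" and ?c = "Suc (Suc (Suc m)) choose Suc l"
  have W: "finite ?W" "card ?W = Suc (Suc (Suc m))" using V i by auto
  have finF: "finite F" by (rule finite_family[OF V(1) F(1)])
  have fin: "\<forall>A\<in>F. finite A" using F(1) by (auto simp: nsets_def)
  have cross: "\<forall>X\<in>?A. \<forall>Y\<in>?B. X \<inter> Y \<noteq> {}"
  proof (intro ballI)
    fix X Y assume XY: "X \<in> ?A" "Y \<in> ?B"
    then have "X \<inter> insert i Y \<noteq> {}"
      using F(2) unfolding deletion_def link_def intersecting_def by blast
    then show "X \<inter> Y \<noteq> {}" using XY(1) unfolding deletion_def by auto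
  qed
  have w: "card ?W = Suc (Suc l) + (Suc m - l)" "Suc l \<le> Suc m - l" "Suc m - l \<le> Suc m"
    using W m by auto
  have sym: "Suc m choose (Suc m - l) = Suc m choose l"
    using binomial_symmetric[of l "Suc m"] m by simp
  have "card ?B * (Suc m choose (Suc m - l)) + card ?A * (Suc m choose Suc l)
      \<le> (card ?W choose Suc l) * (Suc m choose (Suc m - l))"
    using small sym
    by (intro cross_intersecting_ratio[OF W(1) deletion_nsets[OF F(1)] link_nsets[OF F(1)] cross w]) simp
  then have "real (card ?B * (Suc m choose l) + card ?A * (Suc m choose Suc l)) \<le> real (?c * (Suc m choose l))"
    unfolding sym W of_nat_le_iff .
  then have ineq: "real (card ?B) * real (Suc m choose l) + real (card ?A) * real (Suc m choose Suc l)
      \<le> real ?c * real (Suc m choose l)" by simp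
  have "Suc l * (Suc m choose Suc l) = (Suc m - l) * (Suc m choose l)"
    by (simp only: Suc_times_binomial binomial_absorb_comp diff_Suc_1)
  then have "real (Suc l) * real (Suc m choose Suc l) = real (Suc m - l) * real (Suc m choose l)"
    by (metis of_nat_mult)
  then have step: "(real l + 1) * real (Suc m choose Suc l) = (real m + 1 - real l) * real (Suc m choose l)"
    using m by (simp add: of_nat_diff algebra_simps)
  have pos: "0 < real (Suc m choose l)" using m by simp
  have "((real l + 1) * real (card ?B) + (real m + 1 - real l) * real (card ?A)) * real (Suc m choose l)
      = (real l + 1) * (real (card ?B) * real (Suc m choose l))
        + real (card ?A) * ((real l + 1) * real (Suc m choose Suc l))"
    unfolding step by (simp only: algebra_simps)
  also have "\<dots> = (real l + 1) * (real (card ?B) * real (Suc m choose l) + real (card ?A) * real (Suc m choose Suc l))"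
    by (simp only: algebra_simps)
  also have "\<dots> \<le> (real l + 1) * (real ?c * real (Suc m choose l))"
    using ineq by (intro mult_left_mono) auto
  finally have "((real l + 1) * real (card ?B) + (real m + 1 - real l) * real (card ?A)) * real (Suc m choose l)
      \<le> ((real l + 1) * real ?c) * real (Suc m choose l)" by (simp only: mult.assoc)
  then have bound: "(real l + 1) * real (card ?B) + (real m + 1 - real l) * real (card ?A) \<le> (real l + 1) * real ?c"
    using pos by (rule mult_right_le_imp_le)

  define \<delta> where "\<delta> = real (min_degree V t F)"
  define b where "b = real (Suc l choose t)"
  have b0: "0 \<le> b" unfolding b_def by simp
  define K where "K = real l + 2 - real t"
  have K: "0 < K" using t unfolding K_def by simp
  have trace: "card (A \<inter> ?W) = (if i \<in> A then Suc l else Suc (Suc l))" if "A \<in> F" for A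
  proof -
    have A: "A \<subseteq> V" "finite A" "card A = Suc (Suc l)" using that F(1) by (auto simp: nsets_def)
    then have "A \<inter> ?W = A - {i}" by auto
    then show ?thesis using A by simp
  qed
  have "(card ?W choose t) * min_degree V t F \<le> (\<Sum>A\<in>F. card (A \<inter> ?W) choose t)"
    by (rule min_degree_average[OF V(1) _ finF fin]) auto
  also have "\<dots> = (\<Sum>A\<in>F. if i \<in> A then Suc l choose t else Suc (Suc l) choose t)"
    using trace by (intro sum.cong) auto
  also have "\<dots> = card {A \<in> F. i \<in> A} * (Suc l choose t) + card ?A * (Suc (Suc l) choose t)"
    using finF by (simp add: sum.If_cases deletion_def Int_def)
  also have "card {A \<in> F. i \<in> A} = card ?B"
  proof -
    have "F = {A \<in> F. i \<in> A} \<union> ?A" "{A \<in> F. i \<in> A} \<inter> ?A = {}" unfolding deletion_def by auto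
    then have "card F = card {A \<in> F. i \<in> A} + card ?A"
      using finF by (metis card_Un_disjoint finite_Un)
    then show ?thesis using card_link_deletion[OF finF, of i] by simp
  qed
  finally have "real ((card ?W choose t) * min_degree V t F)
      \<le> real (card ?B * (Suc l choose t) + card ?A * (Suc (Suc l) choose t))"
    unfolding of_nat_le_iff .
  then have avg: "real (card ?W choose t) * \<delta> \<le> real (card ?B) * b + real (card ?A) * real (Suc (Suc l) choose t)"
    unfolding \<delta>_def b_def by simp
  have kt: "real (Suc (Suc l) choose t) * K = (real l + 2) * b"
    using binomial_sub_ratio[OF t] unfolding K_def b_def by (simp add: algebra_simps)
  have "(real (card ?W choose t) * \<delta>) * (K * (real l + 1))
      \<le> (real (card ?B) * b + real (card ?A) * real (Suc (Suc l) choose t)) * (K * (real l + 1))"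
    using avg K by (intro mult_right_mono) auto
  also have "\<dots> = real (card ?B) * b * K * (real l + 1)
      + real (card ?A) * (real l + 1) * (real (Suc (Suc l) choose t) * K)"
    by (simp only: algebra_simps)
  also have "\<dots> = real (card ?B) * b * K * (real l + 1)
      + (real (card ?A) * b) * ((real l + 2) * (real l + 1))"
    unfolding kt by (simp only: algebra_simps)
  also have "\<dots> \<le> real (card ?B) * b * K * (real l + 1) + (real (card ?A) * b) * ((real m + 1 - real l) * K)"
    using num b0 unfolding K_def by (intro add_left_mono mult_left_mono) auto
  also have "\<dots> = (b * K) * ((real l + 1) * real (card ?B) + (real m + 1 - real l) * real (card ?A))"
    by (simp only: algebra_simps)
  also have "\<dots> \<le> (b * K) * ((real l + 1) * real ?c)"
    using bound b0 K by (intro mult_left_mono) auto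
  also have "\<dots> = (real ?c * b) * (K * (real l + 1))" by (simp only: algebra_simps)
  finally have "real (card ?W choose t) * \<delta> \<le> real ?c * b"
    by (rule mult_right_le_imp_le) (use K in auto)
  also have "real ?c * b = real (card ?W choose t) * real ((Suc (Suc (Suc m)) - t) choose (Suc l - t))"
    unfolding b_def W(2) of_nat_mult[symmetric] of_nat_eq_iff
    by (rule choose_mult) (use t m in auto)
  finally have "\<delta> \<le> real ((Suc (Suc (Suc m)) - t) choose (Suc l - t))"
    by (rule mult_left_le_imp_le) (use W(2) t m in auto)
  then show ?thesis unfolding \<delta>_def by simp
qed

text \<open>The size bound reads |F| <= c (1 - (n-k)(n-2k)/P) with c = C(n-1,k-1) and P =
  (n-1)(n-2). By \<open>num\<close> this is at most c n(k-t)/(k(n-t)), which is what averaging over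
  all \<open>t\<close>-sets requires.\<close>

lemma min_degree_le_of_small_card:
  assumes F: "F \<subseteq> nsets V (Suc (Suc l))" and V: "finite V" "card V = Suc (Suc (Suc (Suc m)))"
    and small: "card F + (Suc m choose Suc l) \<le> (Suc (Suc (Suc m)) choose Suc l) + (Suc m choose l)"
    and m: "2 * l + 2 \<le> m" and t: "t \<le> Suc l"
    and num: "real t * (real m + 3) * (real m + 2) \<le> (real l + 2) * (real m + 4 - real t) * (real m - 2 * real l)"
  shows "min_degree V t F \<le> (Suc (Suc (Suc m)) - t) choose (Suc l - t)"
proof -
  define c where "c = real (Suc (Suc (Suc m)) choose Suc l)"
  define D where "D = real ((Suc (Suc (Suc m)) - t) choose (Suc l - t))"
  define b where "b = real (Suc l choose t)"
  define K where "K = real l + 2 - real t"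
  define N where "N = real m + 4 - real t"
  define P where "P = (real m + 3) * (real m + 2)"
  define \<delta> where "\<delta> = real (min_degree V t F)"
  define f where "f = real (card F)"
  have pos: "0 < K" "0 < N" "0 < P" "0 \<le> b" "0 \<le> c"
    using t m unfolding K_def N_def P_def b_def c_def by auto
  have finF: "finite F" by (rule finite_family[OF V(1) F])
  have fin: "\<forall>A\<in>F. finite A" using F by (auto simp: nsets_def)
  \<comment> \<open>Absorption identities express C(m+1,l+1) and C(m+1,l) as multiples of
    \<open>c\<close> with common denominator \<open>P\<close>.\<close>
  have "Suc (Suc m) * (Suc m choose Suc l) = (Suc m - l) * (Suc (Suc m) choose Suc l)"
    using binomial_absorb_comp[of "Suc (Suc m)" "Suc l"] by (simp only: diff_Suc_1 diff_Suc_Suc)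
  then have "real (Suc (Suc m)) * real (Suc m choose Suc l) = real (Suc m - l) * real (Suc (Suc m) choose Suc l)"
    by (metis of_nat_mult)
  then have e1: "(real m + 2) * real (Suc m choose Suc l) = (real m + 1 - real l) * real (Suc (Suc m) choose Suc l)"
    using m by (simp add: of_nat_diff algebra_simps)
  have "Suc (Suc (Suc m)) * (Suc (Suc m) choose Suc l) = (Suc (Suc m) - l) * (Suc (Suc (Suc m)) choose Suc l)"
    using binomial_absorb_comp[of "Suc (Suc (Suc m))" "Suc l"] by (simp only: diff_Suc_1 diff_Suc_Suc)
  then have "real (Suc (Suc (Suc m))) * real (Suc (Suc m) choose Suc l) = real (Suc (Suc m) - l) * c"
    unfolding c_def by (metis of_nat_mult)
  then have e2: "(real m + 3) * real (Suc (Suc m) choose Suc l) = (real m + 2 - real l) * c"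
    using m by (simp add: of_nat_diff algebra_simps)
  have "Suc (Suc m) * (Suc m choose l) = (Suc (Suc m) - l) * (Suc (Suc m) choose l)"
    by (simp only: binomial_absorb_comp diff_Suc_1)
  then have "real (Suc (Suc m)) * real (Suc m choose l) = real (Suc (Suc m) - l) * real (Suc (Suc m) choose l)"
    by (metis of_nat_mult)
  then have e3: "(real m + 2) * real (Suc m choose l) = (real m + 2 - real l) * real (Suc (Suc m) choose l)"
    using m by (simp add: of_nat_diff algebra_simps)
  have "Suc (Suc (Suc m)) * (Suc (Suc m) choose l) = Suc l * (Suc (Suc (Suc m)) choose Suc l)"
    by (simp only: Suc_times_binomial)
  then have "real (Suc (Suc (Suc m))) * real (Suc (Suc m) choose l) = real (Suc l) * c"
    unfolding c_def by (metis of_nat_mult)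
  then have e4: "(real m + 3) * real (Suc (Suc m) choose l) = (real l + 1) * c"
    by (simp add: algebra_simps)
  have "P * real (Suc m choose Suc l) = (real m + 3) * ((real m + 2) * real (Suc m choose Suc l))"
    unfolding P_def by (simp only: algebra_simps)
  also have "\<dots> = (real m + 1 - real l) * ((real m + 3) * real (Suc (Suc m) choose Suc l))"
    unfolding e1 by (simp only: algebra_simps)
  finally have g1: "P * real (Suc m choose Suc l) = (real m + 1 - real l) * (real m + 2 - real l) * c"
    unfolding e2 by (simp only: algebra_simps)
  have "P * real (Suc m choose l) = (real m + 3) * ((real m + 2) * real (Suc m choose l))"
    unfolding P_def by (simp only: algebra_simps)
  also have "\<dots> = (real m + 2 - real l) * ((real m + 3) * real (Suc (Suc m) choose l))"
    unfolding e3 by (simp only: algebra_simps)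
  finally have g2: "P * real (Suc m choose l) = (real m + 2 - real l) * (real l + 1) * c"
    unfolding e4 by (simp only: algebra_simps)
  have "real (card F + (Suc m choose Suc l)) \<le> real ((Suc (Suc (Suc m)) choose Suc l) + (Suc m choose l))"
    using small unfolding of_nat_le_iff .
  then have "f \<le> c + real (Suc m choose l) - real (Suc m choose Suc l)"
    unfolding f_def c_def by simp
  then have "P * f \<le> P * (c + real (Suc m choose l) - real (Suc m choose Suc l))"
    using pos by (intro mult_left_mono) auto
  also have "\<dots> = P * c + P * real (Suc m choose l) - P * real (Suc m choose Suc l)"
    by (simp only: algebra_simps)
  also have "\<dots> = c * (P - (real m + 2 - real l) * (real m - 2 * real l))"
    unfolding g1 g2 by (simp add: algebra_simps)
  finally have Pf: "P * f \<le> c * (P - (real m + 2 - real l) * (real m - 2 * real l))" .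
  have "0 \<le> real m + 2 - real l" using m by simp
  from mult_left_mono[OF num this]
  have num': "(real m + 2 - real l) * (real t * P)
      \<le> (real l + 2) * N * ((real m + 2 - real l) * (real m - 2 * real l))"
    unfolding P_def N_def by (simp only: algebra_simps)
  \<comment> \<open>That is, k(n-t) = n(k-t) + t(n-k); \<open>num'\<close> serves to cancel the last
    term.\<close>
  have nk: "(real l + 2) * N = K * (real m + 4) + real t * (real m + 2 - real l)"
    unfolding N_def K_def by (simp add: algebra_simps)
  have "P * ((real l + 2) * N * f) = ((real l + 2) * N) * (P * f)"
    by (simp only: algebra_simps)
  also have "\<dots> \<le> ((real l + 2) * N) * (c * (P - (real m + 2 - real l) * (real m - 2 * real l)))"
    using Pf pos by (intro mult_left_mono) auto
  also have "\<dots> = c * (((real l + 2) * N) * P - (real l + 2) * N * ((real m + 2 - real l) * (real m - 2 * real l)))"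
    by (simp only: algebra_simps)
  also have "\<dots> \<le> c * (((real l + 2) * N) * P - (real m + 2 - real l) * (real t * P))"
    using num' pos by (intro mult_left_mono) auto
  also have "\<dots> = P * (K * (real m + 4) * c)"
    unfolding nk by (simp only: algebra_simps)
  finally have size: "(real l + 2) * N * f \<le> K * (real m + 4) * c"
    using pos(3) by (rule mult_left_le_imp_le)

  have "(card V choose t) * min_degree V t F \<le> (\<Sum>A\<in>F. card (A \<inter> V) choose t)"
    by (rule min_degree_average[OF V(1) _ finF fin]) auto
  also have "\<dots> = (\<Sum>A\<in>F. Suc (Suc l) choose t)"
  proof (rule sum.cong[OF refl])
    fix A assume "A \<in> F"
    then have "A \<subseteq> V" "card A = Suc (Suc l)" using F by (auto simp: nsets_def)
    then show "card (A \<inter> V) choose t = Suc (Suc l) choose t" by (simp add: Int_absorb2)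
  qed
  finally have "real ((card V choose t) * min_degree V t F) \<le> real (card F * (Suc (Suc l) choose t))"
    unfolding of_nat_le_iff by simp
  then have avg: "real (card V choose t) * \<delta> \<le> f * real (Suc (Suc l) choose t)"
    unfolding \<delta>_def f_def by simp
  have kt: "real (Suc (Suc l) choose t) * K = (real l + 2) * b"
    using binomial_sub_ratio[OF t] unfolding K_def b_def by (simp add: algebra_simps)
  have nt: "real (card V choose t) * N = (real m + 4) * real (Suc (Suc (Suc m)) choose t)"
    using binomial_sub_ratio[of t "Suc (Suc (Suc m))"] t m V(2) unfolding N_def by (simp add: algebra_simps)
  have "(Suc (Suc (Suc m)) choose Suc l) * (Suc l choose t)
      = (Suc (Suc (Suc m)) choose t) * ((Suc (Suc (Suc m)) - t) choose (Suc l - t))"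
    by (rule choose_mult) (use t m in auto)
  then have cb: "c * b = real (Suc (Suc (Suc m)) choose t) * D"
    unfolding c_def b_def D_def by (metis of_nat_mult)
  have "(real (card V choose t) * \<delta>) * (K * N) \<le> (f * real (Suc (Suc l) choose t)) * (K * N)"
    using avg pos by (intro mult_right_mono) auto
  also have "\<dots> = f * N * (real (Suc (Suc l) choose t) * K)" by (simp only: algebra_simps)
  also have "\<dots> = b * ((real l + 2) * N * f)" unfolding kt by (simp only: algebra_simps)
  also have "\<dots> \<le> b * (K * (real m + 4) * c)" using size pos by (intro mult_left_mono) auto
  also have "\<dots> = K * (real m + 4) * (c * b)" by (simp only: algebra_simps)
  also have "\<dots> = K * D * ((real m + 4) * real (Suc (Suc (Suc m)) choose t))"
    unfolding cb by (simp only: algebra_simps)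
  also have "\<dots> = (real (card V choose t) * D) * (K * N)"
    unfolding nt[symmetric] by (simp only: algebra_simps)
  finally have "real (card V choose t) * \<delta> \<le> real (card V choose t) * D"
    by (rule mult_right_le_imp_le) (use pos in auto)
  moreover have "0 < real (card V choose t)" using V(2) t m by simp
  ultimately have "\<delta> \<le> D" by (rule mult_left_le_imp_le)
  then show ?thesis unfolding \<delta>_def D_def by simp
qed

section \<open>Numerical conditions and the two degree bounds\<close>

text \<open>\<open>num1\<close> serves the case of a point with diversity at most C(n-3,k-2),
  \<open>num2\<close> the case without such a point.\<close>

lemma min_degree_intersecting_le:
  assumes F: "F \<subseteq> nsets {1..n} k" "intersecting F" and k: "2 \<le> k" "2 * k + 2 \<le> n" and t: "t < k"
    and num1: "real k * (real k - 1) \<le> (real n - real k - 1) * (real k - real t)"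
    and num2: "real t * (real n - 1) * (real n - 2) \<le> real k * (real n - real t) * (real n - 2 * real k)"
  shows "min_degree {1..n} t F \<le> (n - t - 1) choose (k - t - 1)"
proof -
  define l where "l = k - 2"
  define m where "m = n - 4"
  have kl: "k = Suc (Suc l)" and nm: "n = Suc (Suc (Suc (Suc m)))" using k unfolding l_def m_def by auto
  have m: "2 * l + 2 \<le> m" and t': "t \<le> Suc l" using k t kl nm by auto
  have eq: "n - t - 1 = Suc (Suc (Suc m)) - t" "k - t - 1 = Suc l - t" using kl nm by auto
  have V: "card {1..n} = Suc (Suc (Suc (Suc m)))" using nm by simp
  have r: "real k = real l + 2" "real n = real m + 4" using kl nm by auto
  show ?thesis
  proof (cases "\<exists>i\<in>{1..n}. card (deletion i F) \<le> Suc m choose l")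
    case True
    then obtain i where i: "i \<in> {1..n}" "card (deletion i F) \<le> Suc m choose l" by blast
    have "(real l + 2) * (real l + 1) \<le> (real m + 1 - real l) * (real l + 2 - real t)"
      using num1 unfolding r by (simp add: algebra_simps)
    then show ?thesis
      unfolding eq using F kl
      by (intro min_degree_le_of_small_deletion[OF _ F(2) _ V i m t']) auto
  next
    case False
    then have "\<forall>i\<in>{1..n}. Suc m choose l < card (deletion i F)" by (auto simp: not_le)
    then have "card F + (Suc m choose Suc l) \<le> (Suc (Suc (Suc m)) choose Suc l) + (Suc m choose l)"
      using F m unfolding kl nm by (intro intersecting_card_le_of_large_deletions) auto
    moreover have "real t * (real m + 3) * (real m + 2) \<le> (real l + 2) * (real m + 4 - real t) * (real m - 2 * real l)"
      using num2 unfolding r by (simp add: algebra_simps)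
    ultimately show ?thesis
      unfolding eq using F kl by (intro min_degree_le_of_small_card[OF _ _ V _ m t']) auto
  qed
qed

lemma min_degree_one_le:
  assumes F: "F \<subseteq> nsets {1..n} k" "intersecting F" and n: "2 * k + 2 \<le> n" and k: "1 \<le> k"
  shows "min_degree {1..n} 1 F \<le> choose_int (n - 2) (int k - 2)"
proof (cases "k = 1")
  case True
  \<comment> \<open>For \<open>k = 1\<close> the bound is 0: an intersecting family of singletons
    has at most one member, and a point outside it has degree 0.\<close>
  have single: "\<exists>x. A = {x}" if "A \<in> F" for A
  proof -
    have "card A = 1" using that F(1) True by (auto simp: nsets_def)
    then show ?thesis by (rule card_1_singletonE) blast
  qed
  have "F \<subseteq> {A}" if A: "A \<in> F" for A
  proof
    fix B assume B: "B \<in> F"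
    obtain x y where xy: "A = {x}" "B = {y}"
      using single[OF A] single[OF B] by blast
    have "A \<inter> B \<noteq> {}" using F(2) A B unfolding intersecting_def by blast
    then show "B \<in> {A}" using xy by auto
  qed
  then obtain A where FA: "F \<subseteq> {A}" by (cases "F = {}") auto
  obtain x where x: "x \<in> {1..n}" "\<not> {x} \<subseteq> A \<or> A \<notin> F"
  proof (cases "A \<in> F")
    case True
    then obtain y where "A = {y}" using single by blast
    then show ?thesis using n by (intro that[of "if y = 1 then 2 else 1"]) auto
  qed (use n that[of 1] in auto)
  have "{B \<in> F. {x} \<subseteq> B} = {}" using FA x(2) by auto
  then have "degree F {x} = 0" unfolding degree_def by (simp only: card.empty)
  moreover have "min_degree {1..n} 1 F \<le> degree F {x}"
    unfolding min_degree_def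
    using x(1) by (intro Min_le finite_imageI finite_imp_finite_nsets imageI) (auto simp: nsets_def)
  ultimately show ?thesis by simp
next
  case False
  then have k2: "2 \<le> k" using k by simp
  have "real (2 * k + 2) \<le> real n" using n unfolding of_nat_le_iff .
  then have rn: "2 * real k + 2 \<le> real n" by simp
  have rk: "2 \<le> real k" using k2 by simp
  have "real k * (real k - 1) \<le> (real n - real k - 1) * (real k - 1)"
    using rn rk by (intro mult_right_mono) auto
  moreover have "1 * (real n - 1) * (real n - 2) \<le> real k * (real n - 1) * (real n - 2 * real k)"
  proof -
    \<comment> \<open>The product equals k(n-2k) - (n-2), so n >= 2k+2 is exactly what the second
      condition needs at t = 1.\<close>
    have "0 \<le> (real k - 1) * (real n - 2 * real k - 2)" using rn rk by (intro mult_nonneg_nonneg) auto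
    then have "real n - 2 \<le> real k * (real n - 2 * real k)" by (simp add: algebra_simps)
    then have "(real n - 1) * (real n - 2) \<le> (real n - 1) * (real k * (real n - 2 * real k))"
      using rn rk by (intro mult_left_mono) auto
    then show ?thesis by (simp add: algebra_simps)
  qed
  ultimately have "min_degree {1..n} 1 F \<le> (n - 1 - 1) choose (k - 1 - 1)"
    using k2 n by (intro min_degree_intersecting_le[OF F]) auto
  moreover have "nat (int k - 2) = k - 1 - 1" using k2 by simp
  ultimately show ?thesis using k2 unfolding choose_int_def by (simp add: numeral_2_eq_2)
qed

text \<open>With d = n - 2k the hypothesis says 3tk <= d(k-t), equivalently t(n+k) <= kd. The latter
  form is the one the size case uses.\<close>

lemma min_degree_t_le:
  assumes F: "F \<subseteq> nsets {1..n} k" "intersecting F" and t: "1 \<le> t" "t < k"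
    and n: "real n \<ge> 2 * real k + 3 * real t / (1 - real t / real k)"
  shows "min_degree {1..n} t F \<le> choose_int (n - t - 1) (int k - int t - 1)"
proof -
  define d where "d = real n - 2 * real k"
  have r: "1 \<le> real t" "real t + 1 \<le> real k" using t by auto
  have "3 * real t / (1 - real t / real k) = 3 * real t * real k / (real k - real t)"
    using r by (simp add: field_simps)
  then have "3 * real t * real k / (real k - real t) \<le> d" using n unfolding d_def by simp
  then have d: "3 * real t * real k \<le> d * (real k - real t)"
    using r by (simp add: pos_divide_le_eq)
  have "0 \<le> 3 * real t * real k / (real k - real t)" using r by (intro divide_nonneg_pos) auto
  then have "0 \<le> d" using \<open>3 * real t * real k / (real k - real t) \<le> d\<close> by linarith
  then have "d * (real k - real t) \<le> d * real k" by (intro mult_left_mono) auto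
  then have "3 * real t * real k \<le> d * real k" using d by simp
  then have d3: "3 * real t \<le> d" by (rule mult_right_le_imp_le) (use r in auto)
  have n2: "2 * k + 2 \<le> n"
  proof -
    have "2 * real k + 2 \<le> real n" using d3 r unfolding d_def by simp
    then have "real (2 * k + 2) \<le> real n" by simp
    then show ?thesis unfolding of_nat_le_iff .
  qed
  have num1: "real k * (real k - 1) \<le> (real n - real k - 1) * (real k - real t)"
  proof -
    have "(real n - real k - 1) * (real k - real t) = (real k - 1) * (real k - real t) + d * (real k - real t)"
      unfolding d_def by (simp add: algebra_simps)
    moreover have "real k * (real k - 1) = (real k - 1) * (real k - real t) + real t * (real k - 1)"
      by (simp add: algebra_simps)
    moreover have "real t * (real k - 1) \<le> 3 * real t * real k"
      using r by (simp add: algebra_simps)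
    ultimately show ?thesis using d by linarith
  qed
  have num2: "real t * (real n - 1) * (real n - 2) \<le> real k * (real n - real t) * (real n - 2 * real k)"
  proof -
    \<comment> \<open>The aim is (n-1)(n-2) <= (n+k)(n-t), where the difference is n(k-t) - tk + 3n
      - 2; then t(n+k) <= kd finishes.\<close>
    have "3 * real t * real k \<le> (real n) * (real k - real t)"
      using d r by (intro order_trans[OF d] mult_right_mono) (auto simp: d_def)
    then have "0 \<le> (real n * (real k - real t) - 3 * real t * real k) + 2 * (real k * real t) + (3 * real n - 2)"
      using n2 by (intro add_nonneg_nonneg) auto
    also have "\<dots> = (real n + real k) * (real n - real t) - (real n - 1) * (real n - 2)"
      by (simp add: algebra_simps)
    finally have "(real n - 1) * (real n - 2) \<le> (real n + real k) * (real n - real t)" by simp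
    then have "real t * ((real n - 1) * (real n - 2)) \<le> real t * ((real n + real k) * (real n - real t))"
      using r by (intro mult_left_mono) auto
    also have "\<dots> = (real t * (real n + real k)) * (real n - real t)" by simp
    also have "\<dots> \<le> (d * real k) * (real n - real t)"
    proof (rule mult_right_mono)
      have "real t * (real n + real k) = 3 * real t * real k + d * real t"
        unfolding d_def by (simp add: algebra_simps)
      also have "\<dots> \<le> d * real k" using d by (simp add: algebra_simps)
      finally show "real t * (real n + real k) \<le> d * real k" .
      show "0 \<le> real n - real t" using n2 t by simp
    qed
    finally show ?thesis unfolding d_def by (simp add: algebra_simps)
  qed
  have "min_degree {1..n} t F \<le> (n - t - 1) choose (k - t - 1)"
    using t n2 by (intro min_degree_intersecting_le[OF F _ _ _ num1 num2]) auto
  moreover have "nat (int k - int t - 1) = k - t - 1" using t by simp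
  ultimately show ?thesis using t unfolding choose_int_def by simp
qed

theorem theorem27:
  "(\<forall>(n::nat) (k::nat) (F::nat set set).
      n \<ge> 2 * k + 2 \<and> 2 * k + 2 > 2 \<and> F \<subseteq> nsets {1..n} k \<and> intersecting F
      \<longrightarrow> min_degree {1..n} 1 F \<le> choose_int (n - 2) (int k - 2)) \<and>
   (\<forall>(n::nat) (k::nat) (t::nat) (F::nat set set).
      1 \<le> t \<and> t < k \<and> real n \<ge> 2 * real k + 3 * real t / (1 - real t / real k) \<and>
      F \<subseteq> nsets {1..n} k \<and> intersecting F
      \<longrightarrow> min_degree {1..n} t F \<le> choose_int (n - t - 1) (int k - int t - 1))"
  by (intro conjI allI impI; elim conjE; (rule min_degree_one_le | rule min_degree_t_le))
    (assumption | simp)+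

end
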